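(* Let $G=\mathrm{GIRG}(n,\beta,w_0,d)$ be a standard GIRG, let $w_c>w_0$ be a constant, let $G_{\le w_c}$ be the subgraph of $G$ induced by all vertices of weight at most $w_c$, and let $K_k(G_{\le w_c})$ be the number of $k$-cliques in $G_{\le w_c}$. Then there is a constant $c_1>0$ such that $$n\,(c_12^dk)^{-k}\le\mathbb{E}[K_k(G_{\le w_c})].$$ Moreover, for any $\epsilon>0$ and all $$k\le\frac{1}{2^dc_1}\exp\Big(\mathcal{W}\big(2^dc_1\log(n^{1-\epsilon})\big)\Big)=\Theta\Big(\frac{\log n}{d+\log\log n}\Big),$$ we have $\mathbb{E}[K_k(G_{\le w_c})]\ge n^{\epsilon}+o(1)$, and $K_k(G_{\le w_c})$ is self-averaging, i.e., $$\lim_{n\to\infty}\frac{\mathrm{Var}[K_k(G_{\le w_c})]}{\mathbb{E}[K_k(G_{\le w_c})]^2}=0.$$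
   Context: Fix constants $\lambda>0$, $w_0>0$, $\beta>2$. A standard GIRG $\mathrm{GIRG}(n,\beta,w_0,d)$ has $n$ vertices; each vertex $v$ independently receives a weight $w_v$ with $\Pr[w_v\le x]=1-(x/w_0)^{1-\beta}$ for $x\ge w_0$, and independently a position $\mathbf{x}_v$ uniform on the torus $\mathbb{T}^d=[0,1)^d$. The distance is $d(\mathbf{x}_u,\mathbf{x}_v)=\max_{1\le i\le d}|x_{ui}-x_{vi}|_C$ with $|a-b|_C=\min\{|a-b|,1-|a-b|\}$. Distinct $u,v$ are adjacent iff $d(\mathbf{x}_u,\mathbf{x}_v)\le \frac12\big(\frac{\lambda w_uw_v}{n}\big)^{1/d}$. The dimension $d=d(n)$ may depend on $n$; asymptotics are as $n\to\infty$. $\mathcal{W}$ denotes the (principal branch of the) Lambert W function, defined by $\mathcal{W}(z)e^{\mathcal{W}(z)}=z$.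
   Formalization: The first bound is stated for 1 ≤ k ≤ n and the later claims for k ≥ 1 (they fail for k = 0 and for k > n), and the Θ-identity for the threshold is stated only for ε < 1, since for ε ≥ 1 it fails or W is undefined for large n. *)

theory Defs
  imports "HOL-Probability.Probability" "HOL-Library.Landau_Symbols"
begin

text \<open>Simple graphs are pairs of a vertex set and a set of two-element edges.\<close>

type_synonym 'v graph = "'v set \<times> 'v set set"

definition induced_subgraph :: "'v graph \<Rightarrow> 'v set \<Rightarrow> 'v graph" where
  "induced_subgraph G U = (fst G \<inter> U, {e \<in> snd G. e \<subseteq> U})"

definition cliques :: "nat \<Rightarrow> 'v graph \<Rightarrow> 'v set set" where
  "cliques k G = {S. S \<subseteq> fst G \<and> card S = k \<and> (\<forall>u\<in>S. \<forall>v\<in>S. u \<noteq> v \<longrightarrow> {u, v} \<in> snd G)}"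

definition weight_cdf :: "real \<Rightarrow> real \<Rightarrow> real \<Rightarrow> real" where
  "weight_cdf \<beta> w0 x = (if x < w0 then 0 else 1 - (x / w0) powr (1 - \<beta>))"

definition weight_distr :: "real \<Rightarrow> real \<Rightarrow> real measure" where
  "weight_distr \<beta> w0 = interval_measure (weight_cdf \<beta> w0)"

definition torus_distr :: "nat \<Rightarrow> (nat \<Rightarrow> real) measure" where
  "torus_distr d = Pi\<^sub>M {..<d} (\<lambda>_. uniform_measure lborel {0..<1})"

definition circle_dist :: "real \<Rightarrow> real \<Rightarrow> real" where
  "circle_dist a b = min \<bar>a - b\<bar> (1 - \<bar>a - b\<bar>)"

text \<open>Meaningful for \<open>d > 0\<close> only, since the maximum is taken over \<open>d\<close> coordinates.\<close>

definition torus_dist :: "nat \<Rightarrow> (nat \<Rightarrow> real) \<Rightarrow> (nat \<Rightarrow> real) \<Rightarrow> real" where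
  "torus_dist d x y = Max ((\<lambda>i. circle_dist (x i) (y i)) ` {..<d})"

text \<open>A sample \<open>\<omega>\<close> assigns to each vertex \<open>v < n\<close> the pair of its weight and its position;
  the product measure makes all of these independent.\<close>

type_synonym girg_sample = "nat \<Rightarrow> real \<times> (nat \<Rightarrow> real)"

definition girg_measure :: "nat \<Rightarrow> real \<Rightarrow> real \<Rightarrow> nat \<Rightarrow> girg_sample measure" where
  "girg_measure n \<beta> w0 d = Pi\<^sub>M {..<n} (\<lambda>_. weight_distr \<beta> w0 \<Otimes>\<^sub>M torus_distr d)"

abbreviation vertex_weight :: "girg_sample \<Rightarrow> nat \<Rightarrow> real" where
  "vertex_weight \<omega> v \<equiv> fst (\<omega> v)"

abbreviation vertex_pos :: "girg_sample \<Rightarrow> nat \<Rightarrow> nat \<Rightarrow> real" where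
  "vertex_pos \<omega> v \<equiv> snd (\<omega> v)"

definition girg_graph :: "real \<Rightarrow> nat \<Rightarrow> nat \<Rightarrow> girg_sample \<Rightarrow> nat graph" where
  "girg_graph lam n d \<omega> =
     ({..<n},
      {{u, v} | u v. u < n \<and> v < n \<and> u \<noteq> v \<and>
         torus_dist d (vertex_pos \<omega> u) (vertex_pos \<omega> v)
           \<le> 1 / 2 * (lam * vertex_weight \<omega> u * vertex_weight \<omega> v / real n) powr (1 / real d)})"

definition light_clique_count :: "real \<Rightarrow> nat \<Rightarrow> nat \<Rightarrow> real \<Rightarrow> nat \<Rightarrow> girg_sample \<Rightarrow> real" where
  "light_clique_count lam n d wc k \<omega> =
     real (card (cliques k (induced_subgraph (girg_graph lam n d \<omega>) {v. vertex_weight \<omega> v \<le> wc})))"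

definition expected_cliques ::
    "real \<Rightarrow> real \<Rightarrow> real \<Rightarrow> nat \<Rightarrow> nat \<Rightarrow> real \<Rightarrow> nat \<Rightarrow> real" where
  "expected_cliques lam \<beta> w0 n d wc k =
     prob_space.expectation (girg_measure n \<beta> w0 d) (light_clique_count lam n d wc k)"

definition variance_cliques ::
    "real \<Rightarrow> real \<Rightarrow> real \<Rightarrow> nat \<Rightarrow> nat \<Rightarrow> real \<Rightarrow> nat \<Rightarrow> real" where
  "variance_cliques lam \<beta> w0 n d wc k =
     prob_space.variance (girg_measure n \<beta> w0 d) (light_clique_count lam n d wc k)"

text \<open>The principal real branch, with domain \<open>z \<ge> - exp (- 1)\<close>; unspecified for smaller \<open>z\<close>.\<close>

definition lambert_W :: "real \<Rightarrow> real" where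
  "lambert_W z = (THE w. - 1 \<le> w \<and> w * exp w = z)"

definition clique_threshold_arg :: "real \<Rightarrow> real \<Rightarrow> nat \<Rightarrow> nat \<Rightarrow> real" where
  "clique_threshold_arg c1 \<epsilon> n d = 2 ^ d * c1 * ln (real n powr (1 - \<epsilon>))"

definition clique_threshold :: "real \<Rightarrow> real \<Rightarrow> nat \<Rightarrow> nat \<Rightarrow> real" where
  "clique_threshold c1 \<epsilon> n d = 1 / (2 ^ d * c1) * exp (lambert_W (clique_threshold_arg c1 \<epsilon> n d))"


lemma lambert_W_props:
  assumes "- exp (- 1) \<le> z"
  shows "- 1 \<le> lambert_W z" and "lambert_W z * exp (lambert_W z) = z"
proof -
  have mono: "a * exp a < b * exp b" if "- 1 \<le> a" "a < b" for a b :: real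
  proof (rule DERIV_pos_imp_increasing_open[OF that(2)])
    fix x assume x: "a < x" "x < b"
    have "((\<lambda>w. w * exp w) has_real_derivative (1 + x) * exp x) (at x)"
      by (auto intro!: derivative_eq_intros simp: algebra_simps)
    moreover have "(1 + x) * exp x > 0" using x that by simp
    ultimately show "\<exists>y. ((\<lambda>w. w * exp w) has_real_derivative y) (at x) \<and> y > 0" by blast
  qed (intro continuous_intros)
  have "\<exists>w. - 1 \<le> w \<and> w \<le> max 0 z \<and> w * exp w = z"
  proof (rule IVT')
    show "max 0 z * exp (max 0 z) \<ge> z"
      by (cases "z \<ge> 0") (auto simp: max_def mult_le_cancel_left1)
  qed (use assms in \<open>auto intro!: continuous_intros\<close>)
  then obtain w where w: "- 1 \<le> w" "w * exp w = z" by blast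
  have "- 1 \<le> lambert_W z \<and> lambert_W z * exp (lambert_W z) = z"
    unfolding lambert_W_def
  proof (rule theI)
    show "- 1 \<le> w \<and> w * exp w = z" using w by simp
    fix v assume "- 1 \<le> v \<and> v * exp v = z"
    then show "v = w" using w mono[of v w] mono[of w v] by (cases v w rule: linorder_cases) auto
  qed
  then show "- 1 \<le> lambert_W z" and "lambert_W z * exp (lambert_W z) = z" by auto
qed

lemma real_distribution_weight_distr:
  assumes "w0 > 0" and "\<beta> > 1"
  shows "real_distribution (weight_distr \<beta> w0)"
    and "cdf (weight_distr \<beta> w0) x = weight_cdf \<beta> w0 x"
proof -
  have le1: "(y / w0) powr (1 - \<beta>) \<le> 1" if "w0 \<le> y" for y
    using powr_mono2'[of "\<beta> - 1" 1 "y / w0"] powr_mono[of "1 - \<beta>" 0 "y / w0"] that assms by simp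
  have mono: "weight_cdf \<beta> w0 x \<le> weight_cdf \<beta> w0 y" if "x \<le> y" for x y
  proof (cases "x < w0")
    case True
    then show ?thesis using le1[of y] by (auto simp: weight_cdf_def)
  next
    case False
    then have "(y / w0) powr (1 - \<beta>) \<le> (x / w0) powr (1 - \<beta>)"
      using that assms by (intro powr_mono2') (auto simp: divide_right_mono)
    then show ?thesis using False that by (auto simp: weight_cdf_def)
  qed
  have eq: "weight_cdf \<beta> w0 = (\<lambda>x. 1 - (max x w0 / w0) powr (1 - \<beta>))"
    using assms by (auto simp: weight_cdf_def max_def fun_eq_iff)
  have cont: "continuous (at_right x) (weight_cdf \<beta> w0)" for x
    unfolding eq using assms by (intro continuous_intros) auto
  have bot: "(weight_cdf \<beta> w0 \<longlongrightarrow> 0) at_bot"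
    by (rule tendsto_eventually)
       (auto simp: weight_cdf_def eventually_at_bot_linorder intro!: exI[of _ "w0 - 1"])
  have "filterlim (\<lambda>x. inverse w0 * x) at_top at_top"
    using assms by (intro filterlim_tendsto_pos_mult_at_top[OF tendsto_const]) (auto simp: filterlim_ident)
  then have "((\<lambda>x. (inverse w0 * x) powr (1 - \<beta>)) \<longlongrightarrow> 0) at_top"
    using assms by (intro tendsto_neg_powr) auto
  then have lim: "((\<lambda>x. 1 - (x / w0) powr (1 - \<beta>)) \<longlongrightarrow> 1) at_top"
    using tendsto_diff[OF tendsto_const[of "1 :: real"]] by (fastforce simp: field_simps)
  have top: "(weight_cdf \<beta> w0 \<longlongrightarrow> 1) at_top"
    by (rule Lim_transform_eventually[OF lim])
       (auto simp: weight_cdf_def eventually_at_top_linorder intro!: exI[of _ w0])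
  show "real_distribution (weight_distr \<beta> w0)"
    unfolding weight_distr_def by (rule real_distribution_interval_measure[OF mono cont bot top])
  show "cdf (weight_distr \<beta> w0) x = weight_cdf \<beta> w0 x"
    unfolding weight_distr_def by (simp add: cdf_interval_measure[OF mono cont bot])
qed

lemma prob_space_girg_measure:
  assumes "w0 > 0" and "\<beta> > 1"
  shows "prob_space (girg_measure n \<beta> w0 d)"
proof -
  interpret W: real_distribution "weight_distr \<beta> w0"
    using assms by (rule real_distribution_weight_distr)
  interpret U: prob_space "uniform_measure lborel {0..<1 :: real}"
    by (rule prob_space_uniform_measure) auto
  interpret T: prob_space "torus_distr d"
    unfolding torus_distr_def by (rule prob_space_PiM) (rule U.prob_space_axioms)
  interpret P: pair_prob_space "weight_distr \<beta> w0" "torus_distr d" ..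
  show ?thesis
    unfolding girg_measure_def by (rule prob_space_PiM) (rule P.prob_space_axioms)
qed

end

theory Submission
  imports Defs "HOL-Real_Asymp.Real_Asymp"
begin

text \<open>
  Let \<open>p\<close> be the probability that a vertex is light and \<open>m = min 1 (\<lambda> w\<^sub>0\<^sup>2)\<close>. For the lower bound,
  a \<open>k\<close>-set is a clique as soon as its vertices are light and all lie within half of the smallest
  possible connection radius of a fixed one among them, which has probability at least
  \<open>p\<^sup>k (m / (2\<^sup>d n))\<^bsup>k-1\<^esup>\<close>; there are at least \<open>(n / k)\<^sup>k\<close> such sets, so \<open>c\<^sub>1 = 1 / (p m)\<close> works.

  For the variance, disjoint \<open>k\<close>-sets are independent. If \<open>S\<close> and \<open>S'\<close> share a vertex \<open>s\<close>, every vertex of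
  \<open>S' - S\<close> lies within the largest possible connection radius of \<open>s\<close>, so both are cliques with
  probability at most \<open>P(S) (C / n)\<^bsup>|S' - S|\<^esup>\<close> where \<open>C = \<lambda> w\<^sub>c\<^sup>2\<close>. Summing over \<open>S'\<close> gives
  \<open>Var \<le> 2\<^sup>k exp C E\<close>. Below the threshold \<open>E \<ge> n\<^bsup>\<epsilon>\<^esup>\<close>, and \<open>k = o(log n)\<close> because \<open>W\<close> tends to
  infinity, uniformly in \<open>d\<close>; hence \<open>Var / E\<^sup>2 \<rightarrow> 0\<close>.
\<close>

section \<open>Star-shaped events in product spaces\<close>

text \<open>Fubini in the single coordinate \<open>v\<close>: as \<open>P\<close> ignores that
  coordinate, it leaves the inner integral. The outer integral stays over all of \<open>I\<close>,
  although its integrand does not see \<open>x v\<close>, so that coordinates can be integrated out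
  one after another on one fixed space.\<close>

lemma emeasure_PiM_Fubini_at:
  fixes M :: "'a measure" and I :: "'i set"
  assumes "prob_space M" and I: "finite I" "v \<in> I"
    and P[measurable]: "Measurable.pred (PiM I (\<lambda>_. M)) P"
    and R[measurable]: "Measurable.pred (PiM I (\<lambda>_. M)) R"
    and indep: "\<And>x y. P (x(v := y)) = P x"
  shows "emeasure (PiM I (\<lambda>_. M)) {x \<in> space (PiM I (\<lambda>_. M)). P x \<and> R x} =
    (\<integral>\<^sup>+x. indicator {x \<in> space (PiM I (\<lambda>_. M)). P x} x * emeasure M {y \<in> space M. R (x(v := y))}
       \<partial>PiM I (\<lambda>_. M))"
proof -
  interpret M: prob_space M by fact
  interpret product_prob_space "\<lambda>_. M" I by unfold_locales
  let ?N = "PiM I (\<lambda>_. M)" and ?N' = "PiM (I - {v}) (\<lambda>_. M)"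
  let ?E = "\<lambda>x. emeasure M {y \<in> space M. R (x(v := y))}"
  have ins: "insert v (I - {v}) = I" using I by auto
  have upd: "x(v := y) \<in> space ?N" if "x \<in> space ?N' \<or> x \<in> space ?N" "y \<in> space M" for x y
    using that I by (auto simp: space_PiM PiE_iff extensional_def)
  have upd_meas: "(\<lambda>(x, y). x(v := y)) \<in> ?N \<Otimes>\<^sub>M M \<rightarrow>\<^sub>M ?N"
    using measurable_add_dim[of v "I" "\<lambda>_. M"] I by (simp add: insert_absorb)
  \<comment> \<open>The measure of a section is measurable in the section point; the set that is cut
    here is \<open>R\<close> pulled back along the update map.\<close>
  have E[measurable]: "?E \<in> borel_measurable ?N"
  proof -
    have "Measurable.pred (?N \<Otimes>\<^sub>M M) (\<lambda>z. R ((\<lambda>(x, y). x(v := y)) z))"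
      using upd_meas by measurable
    then have "{z \<in> space (?N \<Otimes>\<^sub>M M). R ((\<lambda>(x, y). x(v := y)) z)} \<in> sets (?N \<Otimes>\<^sub>M M)"
      by (simp add: pred_def)
    from M.measurable_emeasure_Pair[OF this] show ?thesis
      by (rule measurable_cong[THEN iffD1, rotated])
         (auto simp: space_pair_measure intro!: arg_cong[where f = "emeasure M"])
  qed
  have Fubini: "integral\<^sup>N ?N f = (\<integral>\<^sup>+x. (\<integral>\<^sup>+y. f (x(v := y)) \<partial>M) \<partial>?N')"
    if "f \<in> borel_measurable ?N" for f
    using product_nn_integral_insert[of "I - {v}" v f] that I unfolding ins by simp
  have "emeasure ?N {x \<in> space ?N. P x \<and> R x}
      = (\<integral>\<^sup>+x. indicator {x \<in> space ?N. P x \<and> R x} x \<partial>?N)"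
    by simp
  also have "\<dots> = (\<integral>\<^sup>+x. (\<integral>\<^sup>+y. indicator {x \<in> space ?N. P x \<and> R x} (x(v := y)) \<partial>M) \<partial>?N')"
    by (rule Fubini) measurable
  also have "\<dots> = (\<integral>\<^sup>+x. of_bool (P x) * ?E x \<partial>?N')"
  proof (rule nn_integral_cong)
    fix x assume x: "x \<in> space ?N'"
    have "{y \<in> space M. R (x(v := y))} \<in> sets M"
    proof -
      have "(\<lambda>y. x(v := y)) \<in> M \<rightarrow>\<^sub>M ?N"
        using measurable_component_update[of x "I - {v}" "\<lambda>_. M" v] x unfolding ins by simp
      then have "Measurable.pred M (\<lambda>y. R (x(v := y)))" by measurable
      then show ?thesis by (simp add: pred_def)
    qed
    then have "?E x = (\<integral>\<^sup>+y. indicator {y \<in> space M. R (x(v := y))} y \<partial>M)"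
      by simp
    also have "of_bool (P x) * \<dots> = (\<integral>\<^sup>+y. indicator {x \<in> space ?N. P x \<and> R x} (x(v := y)) \<partial>M)"
      by (cases "P x") (auto simp: indep upd x intro!: nn_integral_cong split: split_indicator)
    finally show "(\<integral>\<^sup>+y. indicator {x \<in> space ?N. P x \<and> R x} (x(v := y)) \<partial>M) = of_bool (P x) * ?E x"
      by (rule sym)
  qed
  \<comment> \<open>Coordinate \<open>v\<close> is put back: the integrand does not depend on it and
    \<open>M\<close> has mass 1.\<close>
  also have "\<dots> = (\<integral>\<^sup>+x. (\<integral>\<^sup>+y. (indicator {x \<in> space ?N. P x} (x(v := y)) * ?E (x(v := y))) \<partial>M) \<partial>?N')"
  proof (rule nn_integral_cong)
    fix x assume x: "x \<in> space ?N'"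
    have "(\<integral>\<^sup>+y. (indicator {x \<in> space ?N. P x} (x(v := y)) * ?E (x(v := y))) \<partial>M)
       = (\<integral>\<^sup>+y. of_bool (P x) * ?E x \<partial>M)"
      by (intro nn_integral_cong) (auto simp: indep upd x)
    then show "of_bool (P x) * ?E x = (\<integral>\<^sup>+y. (indicator {x \<in> space ?N. P x} (x(v := y)) * ?E (x(v := y))) \<partial>M)"
      by (simp add: M.emeasure_space_1)
  qed
  also have "\<dots> = (\<integral>\<^sup>+x. indicator {x \<in> space ?N. P x} x * ?E x \<partial>?N)"
    by (rule Fubini[symmetric]) measurable
  finally show ?thesis .
qed

text \<open>Given the centre \<open>x s\<close>, the leaves are independent. In the induction,
  neither \<open>P\<close> nor the constraints on the earlier leaves read the new coordinate
  \<open>u\<close>, so integrating it out costs a factor of at most \<open>c\<close>.\<close>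

lemma emeasure_PiM_star_le:
  fixes M :: "'a measure" and I :: "'i set"
  assumes "prob_space M" and I: "finite I" "J \<subseteq> I" "s \<in> I" "s \<notin> J"
    and P[measurable]: "Measurable.pred (PiM I (\<lambda>_. M)) P"
    and R[measurable]: "Measurable.pred (M \<Otimes>\<^sub>M M) (\<lambda>(x, y). R x y)"
    and indep: "\<And>x y v. v \<in> J \<Longrightarrow> P (x(v := y)) = P x"
    and bound: "\<And>x. x \<in> space M \<Longrightarrow> emeasure M {y \<in> space M. R x y} \<le> c"
  shows "emeasure (PiM I (\<lambda>_. M)) {x \<in> space (PiM I (\<lambda>_. M)). P x \<and> (\<forall>v\<in>J. R (x s) (x v))}
    \<le> emeasure (PiM I (\<lambda>_. M)) {x \<in> space (PiM I (\<lambda>_. M)). P x} * c ^ card J"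
proof -
  have "finite J" using I finite_subset by auto
  then show ?thesis using I(2,4) indep
  proof (induction J)
    case (insert u J)
    let ?N = "PiM I (\<lambda>_. M)"
    have [measurable]: "Measurable.pred ?N (\<lambda>x. R (x s) (x v))" if "v \<in> I" for v
    proof -
      have "(\<lambda>x. (x s, x v)) \<in> ?N \<rightarrow>\<^sub>M M \<Otimes>\<^sub>M M" using that I by measurable
      from measurable_compose[OF this R] show ?thesis by simp
    qed
    have [measurable]: "Measurable.pred ?N (\<lambda>x. P x \<and> (\<forall>v\<in>J. R (x s) (x v)))"
      using insert.hyps insert.prems by (auto intro!: pred_intros_finite pred_intros_logic)
    let ?A = "{x \<in> space ?N. P x \<and> (\<forall>v\<in>J. R (x s) (x v))}"
    have "{x \<in> space ?N. P x \<and> (\<forall>v\<in>insert u J. R (x s) (x v))}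
       = {x \<in> space ?N. (P x \<and> (\<forall>v\<in>J. R (x s) (x v))) \<and> R (x s) (x u)}" by auto
    also have "emeasure ?N \<dots>
       = (\<integral>\<^sup>+x. indicator ?A x * emeasure M {y \<in> space M. R ((x(u := y)) s) ((x(u := y)) u)} \<partial>?N)"
    proof (intro emeasure_PiM_Fubini_at assms)
      fix x y
      have "(\<forall>v\<in>J. R ((x(u := y)) s) ((x(u := y)) v)) = (\<forall>v\<in>J. R (x s) (x v))"
        using insert.hyps insert.prems by (intro ball_cong) auto
      moreover have "P (x(u := y)) = P x" by (rule insert.prems(3)) simp
      ultimately show "(P (x(u := y)) \<and> (\<forall>v\<in>J. R ((x(u := y)) s) ((x(u := y)) v)))
          = (P x \<and> (\<forall>v\<in>J. R (x s) (x v)))"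
        by (simp only:)
    qed (use insert.prems in auto)
    also have "\<dots> \<le> (\<integral>\<^sup>+x. indicator ?A x * c \<partial>?N)"
      using insert.prems I
      by (intro nn_integral_mono mult_left_mono) (auto intro!: bound simp: space_PiM PiE_iff)
    also have "\<dots> = emeasure ?N ?A * c" by (simp add: nn_integral_multc)
    also have "\<dots> \<le> emeasure ?N {x \<in> space ?N. P x} * c ^ card J * c"
      using insert by (intro mult_right_mono) auto
    finally show ?case using insert.hyps by (simp add: mult_ac)
  qed simp
qed

text \<open>The counterpart from below. Here \<open>P\<close> restricts the centre alone, so a lower
  bound on the leaf probability is asked only of centres that satisfy \<open>P\<close>.\<close>

lemma emeasure_PiM_star_ge:
  fixes M :: "'a measure" and I :: "'i set"
  assumes "prob_space M" and I: "finite I" "J \<subseteq> I" "s \<in> I" "s \<notin> J"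
    and P[measurable]: "Measurable.pred M P"
    and R[measurable]: "Measurable.pred (M \<Otimes>\<^sub>M M) (\<lambda>(x, y). R x y)"
    and bound: "\<And>x. x \<in> space M \<Longrightarrow> P x \<Longrightarrow> c \<le> emeasure M {y \<in> space M. R x y}"
  shows "emeasure M {x \<in> space M. P x} * c ^ card J \<le>
    emeasure (PiM I (\<lambda>_. M)) {x \<in> space (PiM I (\<lambda>_. M)). P (x s) \<and> (\<forall>v\<in>J. R (x s) (x v))}"
proof -
  let ?N = "PiM I (\<lambda>_. M)"
  interpret M: prob_space M by fact
  interpret N: prob_space ?N by (intro prob_space_PiM assms)
  have [measurable]: "Measurable.pred ?N (\<lambda>x. P (x s))" using I by measurable
  have "finite J" using I finite_subset by auto
  then show ?thesis using I(2,4)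
  proof (induction J)
    case empty
    \<comment> \<open>With no leaves left, the centre itself is integrated out, with
      \<open>True\<close> as the predicate that ignores its coordinate.\<close>
    have "emeasure ?N {x \<in> space ?N. True \<and> P (x s)}
       = (\<integral>\<^sup>+x. indicator {x \<in> space ?N. True} x * emeasure M {y \<in> space M. P ((x(s := y)) s)} \<partial>?N)"
      using I by (intro emeasure_PiM_Fubini_at assms) auto
    then show ?case by (simp add: nn_integral_multc N.emeasure_space_1)
  next
    case (insert u J)
    have [measurable]: "Measurable.pred ?N (\<lambda>x. R (x s) (x v))" if "v \<in> I" for v
    proof -
      have "(\<lambda>x. (x s, x v)) \<in> ?N \<rightarrow>\<^sub>M M \<Otimes>\<^sub>M M" using that I by measurable
      from measurable_compose[OF this R] show ?thesis by simp
    qed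
    have [measurable]: "Measurable.pred ?N (\<lambda>x. P (x s) \<and> (\<forall>v\<in>J. R (x s) (x v)))"
      using insert.hyps insert.prems by (auto intro!: pred_intros_finite pred_intros_logic)
    let ?A = "{x \<in> space ?N. P (x s) \<and> (\<forall>v\<in>J. R (x s) (x v))}"
    have "emeasure M {x \<in> space M. P x} * c ^ card (insert u J)
       = emeasure M {x \<in> space M. P x} * c ^ card J * c" using insert.hyps by (simp add: mult_ac)
    also have "\<dots> \<le> emeasure ?N ?A * c" using insert by (intro mult_right_mono) auto
    also have "\<dots> = (\<integral>\<^sup>+x. indicator ?A x * c \<partial>?N)" by (simp add: nn_integral_multc)
    also have "\<dots> \<le> (\<integral>\<^sup>+x. indicator ?A x * emeasure M {y \<in> space M. R ((x(u := y)) s) ((x(u := y)) u)} \<partial>?N)"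
      using insert.prems I
      by (intro nn_integral_mono) (auto intro!: bound simp: space_PiM PiE_iff split: split_indicator)
    also have "\<dots> = emeasure ?N {x \<in> space ?N. (P (x s) \<and> (\<forall>v\<in>J. R (x s) (x v))) \<and> R (x s) (x u)}"
      using insert by (intro emeasure_PiM_Fubini_at[symmetric] assms) auto
    also have "{x \<in> space ?N. (P (x s) \<and> (\<forall>v\<in>J. R (x s) (x v))) \<and> R (x s) (x u)}
       = {x \<in> space ?N. P (x s) \<and> (\<forall>v\<in>insert u J. R (x s) (x v))}" by auto
    finally show ?case .
  qed
qed

section \<open>Balls in the torus\<close>

abbreviation unit_unif :: "real measure" where
  "unit_unif \<equiv> uniform_measure lborel {0..<1}"

lemma prob_space_unit_unif: "prob_space unit_unif"
  by (rule prob_space_uniform_measure) auto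

lemma circle_dist_commute: "circle_dist a b = circle_dist b a"
  by (simp add: circle_dist_def abs_minus_commute)

text \<open>The four cases fix which branch of each minimum on the right is attained; the left side
  is below both of its branches, so every case is linear. Outside the unit interval the inequality
  can fail.\<close>

lemma circle_dist_triangle:
  assumes "0 \<le> a" "a < 1" "0 \<le> b" "b < 1" "0 \<le> c" "c < 1"
  shows "circle_dist b c \<le> circle_dist a b + circle_dist a c"
  proof -
  consider "circle_dist a b = \<bar>a - b\<bar>" "circle_dist a c = \<bar>a - c\<bar>"
    | "circle_dist a b = 1 - \<bar>a - b\<bar>" "circle_dist a c = \<bar>a - c\<bar>"
    | "circle_dist a b = \<bar>a - b\<bar>" "circle_dist a c = 1 - \<bar>a - c\<bar>"
    | "circle_dist a b = 1 - \<bar>a - b\<bar>" "circle_dist a c = 1 - \<bar>a - c\<bar>"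
    unfolding circle_dist_def min_def by metis
  moreover have "circle_dist b c \<le> \<bar>b - c\<bar>" "circle_dist b c \<le> 1 - \<bar>b - c\<bar>"
    unfolding circle_dist_def by (auto simp: min.cobounded1 min.cobounded2)
  ultimately show ?thesis
    by cases (use assms in linarith)+
qed

lemma circle_dist_measurable[measurable]:
  "(\<lambda>x. circle_dist (f x) (g x)) \<in> borel_measurable M"
  if "f \<in> borel_measurable M" "g \<in> borel_measurable M"
  using that unfolding circle_dist_def by measurable

lemma circle_ball_sets: "{t. 0 \<le> t \<and> t < 1 \<and> circle_dist a t \<le> \<rho>} \<in> sets borel"
  by measurable

lemma emeasure_circle_ball:
  "emeasure unit_unif {t. 0 \<le> t \<and> t < 1 \<and> circle_dist a t \<le> \<rho>}
     = emeasure lborel {t. 0 \<le> t \<and> t < 1 \<and> circle_dist a t \<le> \<rho>}"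
proof -
  have "{0..<1} \<inter> {t. 0 \<le> t \<and> t < 1 \<and> circle_dist a t \<le> \<rho>} = {t. 0 \<le> t \<and> t < 1 \<and> circle_dist a t \<le> \<rho>}"
    by auto
  then show ?thesis
    by (subst emeasure_uniform_measure) (simp_all add: circle_ball_sets divide_ennreal_def)
qed

text \<open>The ball is covered by the interval around \<open>a\<close> clipped to the unit interval
  and by two pieces that wrap around. \<open>?B\<close> has the length that is clipped off at 1 and
  \<open>?C\<close> the length clipped off at 0, so the total is exactly
  \<open>2 * \<rho>\<close>.\<close>

lemma emeasure_circle_ball_le:
  assumes a: "0 \<le> a" "a < 1" and "0 \<le> \<rho>"
  shows "emeasure unit_unif {t. 0 \<le> t \<and> t < 1 \<and> circle_dist a t \<le> \<rho>} \<le> ennreal (2 * \<rho>)"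
proof -
  let ?A = "{max 0 (a - \<rho>)..min 1 (a + \<rho>)}" and ?B = "{0..max 0 (a + \<rho> - 1)}"
    and ?C = "{1 - max 0 (\<rho> - a)..1}"
  have "emeasure lborel {t. 0 \<le> t \<and> t < 1 \<and> circle_dist a t \<le> \<rho>} \<le> emeasure lborel (?A \<union> (?B \<union> ?C))"
  proof (intro emeasure_mono subsetI)
    fix t assume "t \<in> {t. 0 \<le> t \<and> t < 1 \<and> circle_dist a t \<le> \<rho>}"
    then have t: "0 \<le> t" "t < 1" and "\<bar>a - t\<bar> \<le> \<rho> \<or> 1 - \<bar>a - t\<bar> \<le> \<rho>"
      by (auto simp: circle_dist_def min_le_iff_disj)
    then consider "a - \<rho> \<le> t" "t \<le> a + \<rho>" | "t \<le> a + \<rho> - 1" | "a + 1 - \<rho> \<le> t"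
      by linarith
    then show "t \<in> ?A \<union> (?B \<union> ?C)"
    proof cases
      case 3
      then have "1 - max 0 (\<rho> - a) \<le> t" by linarith
      then have "t \<in> ?C" using t by simp
      then show ?thesis by blast
    next
      case 1
      then show ?thesis using t by simp
    next
      case 2
      then show ?thesis using t by simp
    qed
  qed simp
  also have "\<dots> \<le> emeasure lborel ?A + emeasure lborel (?B \<union> ?C)"
    by (rule emeasure_subadditive) auto
  also have "\<dots> \<le> emeasure lborel ?A + (emeasure lborel ?B + emeasure lborel ?C)"
    by (intro add_left_mono emeasure_subadditive) auto
  also have "\<dots> = ennreal (2 * \<rho>)"
  proof -
    have le: "max 0 (a - \<rho>) \<le> min 1 (a + \<rho>)" using assms by simp
    have "min 1 (a + \<rho>) + max 0 (a + \<rho> - 1) = a + \<rho>" by (simp add: min_def max_def)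
    moreover have "max 0 (a - \<rho>) - max 0 (\<rho> - a) = a - \<rho>" by (simp add: max_def)
    ultimately have eq: "(min 1 (a + \<rho>) - max 0 (a - \<rho>)) + (max 0 (a + \<rho> - 1) + max 0 (\<rho> - a)) = 2 * \<rho>"
      by linarith
    have "emeasure lborel ?A = ennreal (min 1 (a + \<rho>) - max 0 (a - \<rho>))"
      "emeasure lborel ?B = ennreal (max 0 (a + \<rho> - 1))" "emeasure lborel ?C = ennreal (max 0 (\<rho> - a))"
      using emeasure_lborel_Icc[OF le] emeasure_lborel_Icc[of 0 "max 0 (a + \<rho> - 1)"]
        emeasure_lborel_Icc[of "1 - max 0 (\<rho> - a)" 1] by simp_all
    then have "emeasure lborel ?A + (emeasure lborel ?B + emeasure lborel ?C)
      = ennreal (min 1 (a + \<rho>) - max 0 (a - \<rho>)) + (ennreal (max 0 (a + \<rho> - 1)) + ennreal (max 0 (\<rho> - a)))"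
      by (simp only:)
    also have "\<dots> = ennreal (2 * \<rho>)"
      using le by (subst eq[symmetric]) (simp only: ennreal_plus[symmetric] max.cobounded1 add_nonneg_nonneg diff_ge_0_iff_ge)
    finally show ?thesis .
  qed
  finally show ?thesis by (simp add: emeasure_circle_ball)
qed

text \<open>From radius 1/2 on the ball is the whole circle. Below that it contains an arc of length
  \<open>2 * \<rho>\<close>, which appears as two disjoint intervals if it crosses 0 to the left or
  1 to the right of \<open>a\<close>.\<close>

lemma emeasure_circle_ball_ge:
  assumes a: "0 \<le> a" "a < 1" and "0 \<le> \<rho>"
  shows "ennreal (min 1 (2 * \<rho>)) \<le> emeasure unit_unif {t. 0 \<le> t \<and> t < 1 \<and> circle_dist a t \<le> \<rho>}"
proof -
  let ?S = "{t. 0 \<le> t \<and> t < 1 \<and> circle_dist a t \<le> \<rho>}"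
  have "ennreal (min 1 (2 * \<rho>)) \<le> emeasure lborel ?S"
  proof (cases "\<rho> < 1 / 2")
    case False
    have "circle_dist a t \<le> \<rho>" for t using False unfolding circle_dist_def by linarith
    then have "{0..<1} \<subseteq> ?S" by auto
    then have "emeasure lborel {0..<1::real} \<le> emeasure lborel ?S" by (intro emeasure_mono) auto
    then show ?thesis using False by (simp add: min_def split: if_splits)
  next
    case True
    consider "a < \<rho>" | "\<rho> \<le> a" "a + \<rho> \<le> 1" | "1 < a + \<rho>" by linarith
    then show ?thesis
    proof cases
      case 1
      have "ennreal (min 1 (2 * \<rho>)) = emeasure lborel {0..<a+\<rho>} + emeasure lborel {a+1-\<rho>..<1}"
        using 1 assms True by (simp add: min_absorb2 flip: ennreal_plus)
      also have "\<dots> = emeasure lborel ({0..<a+\<rho>} \<union> {a+1-\<rho>..<1})"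
        using True by (intro plus_emeasure) auto
      also have "\<dots> \<le> emeasure lborel ?S"
        proof (intro emeasure_mono subsetI)
        fix t assume "t \<in> {0..<a+\<rho>} \<union> {a+1-\<rho>..<1}"
        then show "t \<in> ?S" using 1 assms True by (auto simp: circle_dist_def min_le_iff_disj abs_if)
      qed auto
      finally show ?thesis .
    next
      case 2
      have "ennreal (min 1 (2 * \<rho>)) = emeasure lborel {a-\<rho>..<a+\<rho>}"
        using 2 assms True by (simp add: min_absorb2 flip: ennreal_plus)
      also have "\<dots> \<le> emeasure lborel ?S"
        proof (intro emeasure_mono subsetI)
        fix t assume "t \<in> {a-\<rho>..<a+\<rho>}"
        then show "t \<in> ?S" using 2 assms True by (auto simp: circle_dist_def min_le_iff_disj abs_if)
      qed auto
      finally show ?thesis .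
    next
      case 3
      have "ennreal (min 1 (2 * \<rho>)) = emeasure lborel {0..<a+\<rho>-1} + emeasure lborel {a-\<rho>..<1}"
        using 3 assms True by (simp add: min_absorb2 flip: ennreal_plus)
      also have "\<dots> = emeasure lborel ({0..<a+\<rho>-1} \<union> {a-\<rho>..<1})"
        using True by (intro plus_emeasure) auto
      also have "\<dots> \<le> emeasure lborel ?S"
        proof (intro emeasure_mono subsetI)
        fix t assume "t \<in> {0..<a+\<rho>-1} \<union> {a-\<rho>..<1}"
        then show "t \<in> ?S" using 3 assms True by (auto simp: circle_dist_def min_le_iff_disj abs_if)
      qed auto
      finally show ?thesis .
    qed
  qed
  then show ?thesis by (simp add: emeasure_circle_ball)
qed

section \<open>Product structure of the torus and the volume of its balls\<close>

lemma torus_distr_prod: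
  assumes "\<And>i. i < d \<Longrightarrow> A i \<in> sets borel"
  shows "emeasure (torus_distr d) (PiE {..<d} A) = (\<Prod>i<d. emeasure unit_unif (A i))"
proof -
  interpret U: prob_space unit_unif by (rule prob_space_unit_unif)
  interpret product_prob_space "\<lambda>_. unit_unif" "{..<d}" by unfold_locales
  show ?thesis unfolding torus_distr_def using assms by (subst emeasure_PiM) auto
qed

lemma prob_space_torus_distr: "prob_space (torus_distr d)"
  unfolding torus_distr_def by (intro prob_space_PiM prob_space_unit_unif)

lemma space_torus_distr: "space (torus_distr d) = (PiE {..<d} (\<lambda>_. UNIV))"
  by (simp add: torus_distr_def space_PiM)

lemma torus_component_measurable:
  assumes "i < d" "f \<in> M \<rightarrow>\<^sub>M torus_distr d"
  shows "(\<lambda>x. f x i) \<in> borel_measurable M"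
proof -
  have "(\<lambda>x. x i) \<in> torus_distr d \<rightarrow>\<^sub>M borel"
    unfolding torus_distr_def using assms measurable_component_singleton[of i "{..<d}" "\<lambda>_. unit_unif"]
    by simp
  with assms(2) show ?thesis by (rule measurable_compose)
qed

text \<open>Phrased by coordinates rather than with \<open>torus_dist\<close>, so that the ball is a
  product set whose measure factors. Membership in the unit cube matches the position part of a
  light vertex.\<close>

definition torus_ball :: "nat \<Rightarrow> real \<Rightarrow> (nat \<Rightarrow> real) \<Rightarrow> (nat \<Rightarrow> real) \<Rightarrow> bool" where
  "torus_ball d \<rho> x y \<longleftrightarrow> (\<forall>i<d. 0 \<le> y i \<and> y i < 1 \<and> circle_dist (x i) (y i) \<le> \<rho>)"

lemma torus_ball_eq_PiE:
  "{y \<in> space (torus_distr d). torus_ball d \<rho> x y}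
    = PiE {..<d} (\<lambda>i. {t. 0 \<le> t \<and> t < 1 \<and> circle_dist (x i) t \<le> \<rho>})"
  unfolding space_torus_distr torus_ball_def PiE_def Pi_def by blast

lemma sets_torus_ball: "{y \<in> space (torus_distr d). torus_ball d \<rho> x y} \<in> sets (torus_distr d)"
  unfolding torus_ball_eq_PiE
  unfolding torus_distr_def by (auto intro!: sets_PiM_I_finite circle_ball_sets)

lemma emeasure_torus_ball:
  "emeasure (torus_distr d) {y \<in> space (torus_distr d). torus_ball d \<rho> x y}
    = (\<Prod>i<d. emeasure unit_unif {t. 0 \<le> t \<and> t < 1 \<and> circle_dist (x i) t \<le> \<rho>})"
  unfolding torus_ball_eq_PiE by (simp only: torus_distr_prod circle_ball_sets)

lemma emeasure_torus_ball_le: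
  assumes "\<And>i. i < d \<Longrightarrow> 0 \<le> x i \<and> x i < 1" "0 \<le> \<rho>"
  shows "emeasure (torus_distr d) {y \<in> space (torus_distr d). torus_ball d \<rho> x y} \<le> ennreal ((2 * \<rho>) ^ d)"
proof -
  have "(\<Prod>i<d. emeasure unit_unif {t. 0 \<le> t \<and> t < 1 \<and> circle_dist (x i) t \<le> \<rho>})
     \<le> (\<Prod>i<d. ennreal (2 * \<rho>))"
    using assms by (intro prod_mono_ennreal emeasure_circle_ball_le) auto
  then show ?thesis using assms unfolding emeasure_torus_ball by (simp add: ennreal_power)
qed

lemma emeasure_torus_ball_ge:
  assumes "\<And>i. i < d \<Longrightarrow> 0 \<le> x i \<and> x i < 1" "0 \<le> \<rho>"
  shows "ennreal (min 1 (2 * \<rho>) ^ d) \<le> emeasure (torus_distr d) {y \<in> space (torus_distr d). torus_ball d \<rho> x y}"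
proof -
  have "(\<Prod>i<d. ennreal (min 1 (2 * \<rho>)))
     \<le> (\<Prod>i<d. emeasure unit_unif {t. 0 \<le> t \<and> t < 1 \<and> circle_dist (x i) t \<le> \<rho>})"
    using assms by (intro prod_mono_ennreal emeasure_circle_ball_ge) auto
  then show ?thesis using assms unfolding emeasure_torus_ball by (simp add: ennreal_power)
qed

section \<open>Light vertices and light cliques\<close>

locale light_girg =
  fixes lam w0 \<beta> wc :: real
  assumes lam: "lam > 0" and w0: "w0 > 0" and \<beta>: "\<beta> > 2" and wc: "wc > w0"
begin

abbreviation vertex_distr :: "nat \<Rightarrow> (real \<times> (nat \<Rightarrow> real)) measure" where
  "vertex_distr d \<equiv> weight_distr \<beta> w0 \<Otimes>\<^sub>M torus_distr d"

text \<open>Almost surely weights are at least \<open>w0\<close> and positions lie in the unit cube; both conditions are part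
  of the definition because off the cube \<open>circle_dist\<close> can be negative.\<close>

definition light_vertex :: "nat \<Rightarrow> real \<times> (nat \<Rightarrow> real) \<Rightarrow> bool" where
  "light_vertex d y \<longleftrightarrow> w0 \<le> fst y \<and> fst y \<le> wc \<and> (\<forall>i<d. 0 \<le> snd y i \<and> snd y i < 1)"

text \<open>The condition on \<open>torus_dist\<close> with the maximum resolved into its
  coordinates, which makes measurability a finite conjunction. Distinctness of the two vertices is
  imposed where it is used.\<close>

definition adjacent :: "nat \<Rightarrow> nat \<Rightarrow> real \<times> (nat \<Rightarrow> real) \<Rightarrow> real \<times> (nat \<Rightarrow> real) \<Rightarrow> bool" where
  "adjacent n d y z \<longleftrightarrow> (\<forall>i<d. circle_dist (snd y i) (snd z i)
     \<le> 1 / 2 * (lam * fst y * fst z / real n) powr (1 / real d))"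

text \<open>Depends only on the coordinates in \<open>S\<close>. Through \<open>light_vertex\<close>
  it also asks for the almost sure support conditions, so it matches the cliques of the random graph
  only up to a null set.\<close>

definition light_clique :: "nat \<Rightarrow> nat \<Rightarrow> nat set \<Rightarrow> girg_sample \<Rightarrow> bool" where
  "light_clique n d S \<omega> \<longleftrightarrow> (\<forall>v\<in>S. light_vertex d (\<omega> v)) \<and>
     (\<forall>u\<in>S. \<forall>v\<in>S. u \<noteq> v \<longrightarrow> adjacent n d (\<omega> u) (\<omega> v))"

text \<open>The value of \<open>weight_cdf\<close> at \<open>wc\<close>, called \<open>p\<close> in
  the outline above.\<close>

definition light_prob :: real where
  "light_prob = 1 - (wc / w0) powr (1 - \<beta>)"

lemma light_prob: "0 < light_prob" "light_prob \<le> 1"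
proof -
  have "(wc / w0) powr (1 - \<beta>) < 1 powr (1 - \<beta>)"
    using w0 wc \<beta> by (intro powr_less_mono2_neg) auto
  then show "0 < light_prob" by (simp add: light_prob_def)
qed (simp add: light_prob_def)

lemma real_distribution_weight: "real_distribution (weight_distr \<beta> w0)"
  using w0 \<beta> by (intro real_distribution_weight_distr) auto

lemma prob_space_vertex_distr: "prob_space (vertex_distr d)"
proof -
  interpret W: real_distribution "weight_distr \<beta> w0" by (rule real_distribution_weight)
  interpret T: prob_space "torus_distr d" by (rule prob_space_torus_distr)
  interpret P: pair_prob_space "weight_distr \<beta> w0" "torus_distr d" ..
  show ?thesis by (rule P.prob_space_axioms)
qed

lemma prob_space_girg: "prob_space (girg_measure n \<beta> w0 d)"
  using w0 \<beta> by (intro prob_space_girg_measure) auto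

section \<open>Measurability of the vertex and clique predicates\<close>

lemma weight_measurable: "fst \<in> borel_measurable (vertex_distr d)"
  using real_distribution.events_eq_borel[OF real_distribution_weight]
    measurable_fst[of "weight_distr \<beta> w0" "torus_distr d"]
  by (simp cong: measurable_cong_sets)

lemma position_measurable: "i < d \<Longrightarrow> (\<lambda>y. snd y i) \<in> borel_measurable (vertex_distr d)"
  by (rule torus_component_measurable) auto

lemma pred_light_vertex: "Measurable.pred (vertex_distr d) (light_vertex d)"
proof -
  note [measurable] = weight_measurable position_measurable
  show ?thesis unfolding light_vertex_def[abs_def]
    by (auto intro!: pred_intros_logic pred_intros_finite)
qed

lemma pred_adjacent:
  assumes f: "f \<in> M \<rightarrow>\<^sub>M vertex_distr d" and g: "g \<in> M \<rightarrow>\<^sub>M vertex_distr d"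
  shows "Measurable.pred M (\<lambda>x. adjacent n d (f x) (g x))"
proof -
  have "Measurable.pred M (\<lambda>x. circle_dist (snd (f x) i) (snd (g x) i)
      \<le> 1 / 2 * (lam * fst (f x) * fst (g x) / real n) powr (1 / real d))" if "i \<in> {..<d}" for i
  proof -
    have i: "i < d" using that by simp
    note [measurable] = measurable_compose[OF f weight_measurable] measurable_compose[OF g weight_measurable]
      measurable_compose[OF f position_measurable[OF i]] measurable_compose[OF g position_measurable[OF i]]
    show ?thesis by measurable
  qed
  then have "Measurable.pred M (\<lambda>x. \<forall>i\<in>{..<d}. circle_dist (snd (f x) i) (snd (g x) i)
      \<le> 1 / 2 * (lam * fst (f x) * fst (g x) / real n) powr (1 / real d))"
    by (intro pred_intros_finite finite_lessThan)
  then show ?thesis by (simp only: adjacent_def Ball_def lessThan_iff)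
qed

text \<open>The vertex condition \<open>P\<close> is left open because it is used both with
  \<open>light_vertex\<close> and with the bare bound on the weight that occurs in the actual clique
  count.\<close>

lemma pred_clique_of:
  assumes "finite I" "S \<subseteq> I" and P: "Measurable.pred (vertex_distr d) P"
  shows "Measurable.pred (PiM I (\<lambda>_. vertex_distr d)) (\<lambda>\<omega>. (\<forall>v\<in>S. P (\<omega> v)) \<and>
     (\<forall>u\<in>S. \<forall>v\<in>S. u \<noteq> v \<longrightarrow> adjacent n d (\<omega> u) (\<omega> v)))"
proof -
  have S: "finite S" using assms finite_subset by auto
  have comp: "(\<lambda>\<omega>. \<omega> v) \<in> PiM I (\<lambda>_. vertex_distr d) \<rightarrow>\<^sub>M vertex_distr d" if "v \<in> S" for v
    using that assms by (intro measurable_component_singleton) auto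
  have "Measurable.pred (PiM I (\<lambda>_. vertex_distr d)) (\<lambda>\<omega>. \<forall>v\<in>S. P (\<omega> v))"
    using S measurable_compose[OF comp P] by (intro pred_intros_finite) auto
  moreover have "Measurable.pred (PiM I (\<lambda>_. vertex_distr d))
      (\<lambda>\<omega>. \<forall>u\<in>S. \<forall>v\<in>S. u \<noteq> v \<longrightarrow> adjacent n d (\<omega> u) (\<omega> v))"
    using S by (intro pred_intros_finite pred_intros_logic pred_adjacent comp) auto
  ultimately show ?thesis by (rule pred_intros_logic)
qed

lemma pred_light_clique:
  assumes "finite I" "S \<subseteq> I"
  shows "Measurable.pred (PiM I (\<lambda>_. vertex_distr d)) (light_clique n d S)"
  unfolding light_clique_def[abs_def] by (intro pred_clique_of assms pred_light_vertex)

lemma light_clique_upd: "v \<notin> S \<Longrightarrow> light_clique n d S (x(v := y)) = light_clique n d S x"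
  unfolding light_clique_def by (smt (verit) fun_upd_other)

lemma light_clique_restrict: "light_clique n d S (restrict \<omega> S) = light_clique n d S \<omega>"
  unfolding light_clique_def by simp

section \<open>Mass of the light weights and almost sure support of a sample\<close>

lemma emeasure_weight_Icc: "ennreal light_prob \<le> emeasure (weight_distr \<beta> w0) {w0..wc}"
proof -
  interpret W: real_distribution "weight_distr \<beta> w0" by (rule real_distribution_weight)
  have "cdf (weight_distr \<beta> w0) wc - cdf (weight_distr \<beta> w0) w0 = measure (weight_distr \<beta> w0) {w0<..wc}"
    using wc by (rule W.cdf_diff_eq)
  then have "light_prob = measure (weight_distr \<beta> w0) {w0<..wc}"
    using w0 wc \<beta> by (simp add: real_distribution_weight_distr(2) weight_cdf_def light_prob_def)
  also have "\<dots> \<le> measure (weight_distr \<beta> w0) {w0..wc}"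
    by (intro W.finite_measure_mono) auto
  finally show ?thesis by (simp add: W.emeasure_eq_measure)
qed

lemma AE_weight: "AE w in weight_distr \<beta> w0. w0 \<le> w"
proof -
  interpret W: real_distribution "weight_distr \<beta> w0" by (rule real_distribution_weight)
  have "measure (weight_distr \<beta> w0) {..w0} = 0"
    using w0 \<beta> real_distribution_weight_distr(2)[of w0 \<beta> w0] by (simp add: cdf_def weight_cdf_def)
  then have "{..w0} \<in> null_sets (weight_distr \<beta> w0)"
    by (auto simp: null_sets_def W.emeasure_eq_measure)
  then show ?thesis by (rule AE_I') auto
qed

lemma AE_torus: "AE x in torus_distr d. \<forall>i<d. 0 \<le> x i \<and> x i < 1"
proof -
  interpret T: prob_space "torus_distr d" by (rule prob_space_torus_distr)
  have "emeasure (torus_distr d) (PiE {..<d} (\<lambda>_. {0..<1})) = 1"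
    by (subst torus_distr_prod) (auto simp: divide_ennreal_def)
  moreover have "PiE {..<d} (\<lambda>_. {0..<1}) \<in> sets (torus_distr d)"
    unfolding torus_distr_def by (intro sets_PiM_I_finite) auto
  ultimately have "AE x in torus_distr d. x \<in> PiE {..<d} (\<lambda>_. {0..<1})"
    by (intro T.AE_prob_1) (auto simp: T.emeasure_eq_measure)
  then show ?thesis by (rule AE_mp) (auto intro!: AE_I2 simp: PiE_iff)
qed

lemma AE_girg:
  "AE \<omega> in girg_measure n \<beta> w0 d. \<forall>v<n. w0 \<le> fst (\<omega> v) \<and> (\<forall>i<d. 0 \<le> snd (\<omega> v) i \<and> snd (\<omega> v) i < 1)"
proof -
  interpret W: real_distribution "weight_distr \<beta> w0" by (rule real_distribution_weight)
  interpret T: prob_space "torus_distr d" by (rule prob_space_torus_distr)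
  interpret P: pair_prob_space "weight_distr \<beta> w0" "torus_distr d" ..
  let ?good = "\<lambda>y. w0 \<le> fst y \<and> (\<forall>i<d. 0 \<le> snd y i \<and> snd y i < 1)"
  have good: "AE y in vertex_distr d. ?good y"
  proof (rule P.AE_pair_measure)
    have "Measurable.pred (vertex_distr d) (\<lambda>y. 0 \<le> snd y i \<and> snd y i < 1)" if "i \<in> {..<d}" for i
    proof -
      have "(\<lambda>y. snd y i) \<in> borel_measurable (vertex_distr d)"
        using that by (intro position_measurable) auto
      moreover have "Measurable.pred borel (\<lambda>t :: real. 0 \<le> t \<and> t < 1)" by measurable
      ultimately show ?thesis by (rule measurable_compose)
    qed
    then have "Measurable.pred (vertex_distr d) (\<lambda>y. \<forall>i\<in>{..<d}. 0 \<le> snd y i \<and> snd y i < 1)"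
      by (intro pred_intros_finite finite_lessThan)
    moreover have "Measurable.pred (vertex_distr d) (\<lambda>y. w0 \<le> fst y)"
      using weight_measurable by measurable
    ultimately have "Measurable.pred (vertex_distr d) (\<lambda>y. w0 \<le> fst y \<and> (\<forall>i\<in>{..<d}. 0 \<le> snd y i \<and> snd y i < 1))"
      by (intro pred_intros_logic)
    then show "{y \<in> space (vertex_distr d). ?good y} \<in> sets (vertex_distr d)"
      by (simp only: pred_def Ball_def lessThan_iff)
    show "AE w in weight_distr \<beta> w0. AE x in torus_distr d. ?good (w, x)"
      using AE_weight
    proof eventually_elim
      case (elim w)
      show ?case using AE_torus[of d] by eventually_elim (simp add: elim)
    qed
  qed
  have "AE \<omega> in girg_measure n \<beta> w0 d. ?good (\<omega> v)" if "v < n" for v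
    unfolding girg_measure_def using that good
    by (intro AE_PiM_component prob_space_vertex_distr) auto
  then have "AE \<omega> in girg_measure n \<beta> w0 d. \<forall>v\<in>{..<n}. ?good (\<omega> v)"
    by (intro AE_finite_allI) auto
  then show ?thesis by (simp only: Ball_def lessThan_iff)
qed

section \<open>Clique probabilities\<close>

text \<open>The star relation for both bounds. Its radius is the same for all weights, unlike that
  of \<open>adjacent\<close>. Lightness of both ends is included, so a centre that is not light has
  no near vertices and satisfies every upper bound.\<close>

definition near :: "nat \<Rightarrow> real \<Rightarrow> real \<times> (nat \<Rightarrow> real) \<Rightarrow> real \<times> (nat \<Rightarrow> real) \<Rightarrow> bool" where
  "near d \<rho> x y \<longleftrightarrow> light_vertex d x \<and> light_vertex d y \<and> (\<forall>i<d. circle_dist (snd x i) (snd y i) \<le> \<rho>)"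

lemma pred_near: "Measurable.pred (vertex_distr d \<Otimes>\<^sub>M vertex_distr d) (\<lambda>(x, y). near d \<rho> x y)"
proof -
  let ?V = "vertex_distr d \<Otimes>\<^sub>M vertex_distr d"
  have "Measurable.pred ?V (\<lambda>z. circle_dist (snd (fst z) i) (snd (snd z) i) \<le> \<rho>)" if "i \<in> {..<d}" for i
  proof -
    have pos: "(\<lambda>y. snd y i) \<in> borel_measurable (vertex_distr d)"
      using that by (intro position_measurable) auto
    note [measurable] = measurable_compose[OF measurable_fst pos] measurable_compose[OF measurable_snd pos]
    show ?thesis by measurable
  qed
  then have "Measurable.pred ?V (\<lambda>z. \<forall>i\<in>{..<d}. circle_dist (snd (fst z) i) (snd (snd z) i) \<le> \<rho>)"
    by (intro pred_intros_finite finite_lessThan)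
  moreover have "Measurable.pred ?V (\<lambda>z. light_vertex d (fst z))" "Measurable.pred ?V (\<lambda>z. light_vertex d (snd z))"
    by (rule measurable_compose[OF measurable_fst pred_light_vertex],
        rule measurable_compose[OF measurable_snd pred_light_vertex])
  ultimately have "Measurable.pred ?V (\<lambda>z. light_vertex d (fst z) \<and> light_vertex d (snd z) \<and>
      (\<forall>i\<in>{..<d}. circle_dist (snd (fst z) i) (snd (snd z) i) \<le> \<rho>))"
    by (intro pred_intros_logic)
  then show ?thesis by (simp only: near_def case_prod_beta' Ball_def lessThan_iff)
qed

text \<open>As \<open>\<rho>\<close> does not depend on weights, the event is a rectangle: an
  interval of weights times a torus ball.\<close>

lemma emeasure_near:
  assumes "light_vertex d x"
  shows "emeasure (vertex_distr d) {y \<in> space (vertex_distr d). near d \<rho> x y}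
    = emeasure (weight_distr \<beta> w0) {w0..wc}
      * emeasure (torus_distr d) {y \<in> space (torus_distr d). torus_ball d \<rho> (snd x) y}"
proof -
  interpret W: real_distribution "weight_distr \<beta> w0" by (rule real_distribution_weight)
  interpret T: prob_space "torus_distr d" by (rule prob_space_torus_distr)
  have "{y \<in> space (vertex_distr d). near d \<rho> x y}
      = {w0..wc} \<times> {y \<in> space (torus_distr d). torus_ball d \<rho> (snd x) y}"
    using assms by (auto simp: near_def torus_ball_def light_vertex_def space_pair_measure)
  then show ?thesis
    using sets_torus_ball by (simp add: T.emeasure_pair_measure_Times)
qed

lemma emeasure_near_le:
  assumes "0 \<le> \<rho>"
  shows "emeasure (vertex_distr d) {y \<in> space (vertex_distr d). near d \<rho> x y} \<le> ennreal ((2 * \<rho>) ^ d)"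
proof (cases "light_vertex d x")
  case True
  interpret W: real_distribution "weight_distr \<beta> w0" by (rule real_distribution_weight)
  have "emeasure (weight_distr \<beta> w0) {w0..wc}
      * emeasure (torus_distr d) {y \<in> space (torus_distr d). torus_ball d \<rho> (snd x) y}
    \<le> 1 * ennreal ((2 * \<rho>) ^ d)"
    using True assms by (intro mult_mono emeasure_torus_ball_le W.emeasure_le_1) (auto simp: light_vertex_def)
  then show ?thesis using True by (simp add: emeasure_near)
qed (simp add: near_def)

lemma emeasure_near_ge:
  assumes "0 \<le> \<rho>" "light_vertex d x"
  shows "ennreal (light_prob * min 1 (2 * \<rho>) ^ d)
    \<le> emeasure (vertex_distr d) {y \<in> space (vertex_distr d). near d \<rho> x y}"
proof -
  have "ennreal light_prob * ennreal (min 1 (2 * \<rho>) ^ d)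
     \<le> emeasure (weight_distr \<beta> w0) {w0..wc}
      * emeasure (torus_distr d) {y \<in> space (torus_distr d). torus_ball d \<rho> (snd x) y}"
    using assms by (intro mult_mono emeasure_torus_ball_ge emeasure_weight_Icc) (auto simp: light_vertex_def)
  then show ?thesis using assms light_prob by (simp add: emeasure_near ennreal_mult)
qed

text \<open>Being near any centre implies being light. For an auxiliary centre at the origin and
  radius 1 the volume factor \<open>min 1 (2 * \<rho>)\<close> is 1, and only the weight factor
  remains.\<close>

lemma emeasure_light_vertex:
  "ennreal light_prob \<le> emeasure (vertex_distr d) {y \<in> space (vertex_distr d). light_vertex d y}"
proof -
  interpret V: prob_space "vertex_distr d" by (rule prob_space_vertex_distr)
  let ?x = "(w0, \<lambda>_. 0) :: real \<times> (nat \<Rightarrow> real)"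
  have x: "light_vertex d ?x" using w0 wc by (simp add: light_vertex_def)
  have "ennreal light_prob \<le> emeasure (vertex_distr d) {y \<in> space (vertex_distr d). near d 1 ?x y}"
    using emeasure_near_ge[of 1 d ?x] x by simp
  also have "\<dots> \<le> emeasure (vertex_distr d) {y \<in> space (vertex_distr d). light_vertex d y}"
    using pred_light_vertex[of d] by (intro emeasure_mono) (auto simp: near_def pred_def)
  finally show ?thesis .
qed

text \<open>Up to the factor \<open>1 / n\<close>, the volume of the smallest connection ball
  between light vertices. The cap at 1 covers balls that fill the torus and later allows an exponent
  to be raised from \<open>k - 1\<close> to \<open>k\<close>.\<close>

definition light_factor :: real where
  "light_factor = min 1 (lam * w0\<^sup>2)"

lemma light_factor: "0 < light_factor" "light_factor \<le> 1"
  using lam w0 by (auto simp: light_factor_def)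

definition clique_prob :: "nat \<Rightarrow> nat \<Rightarrow> nat set \<Rightarrow> real" where
  "clique_prob n d S = measure (girg_measure n \<beta> w0 d) {\<omega> \<in> space (girg_measure n \<beta> w0 d). light_clique n d S \<omega>}"

section \<open>Probability of one clique and of two overlapping cliques\<close>

lemma powr_root_power:
  fixes x :: real
  assumes "0 \<le> x" "1 \<le> d"
  shows "(x powr (1 / real d)) ^ d = x"
  using assms by (cases "x = 0") (auto simp: powr_powr simp flip: powr_realpow)

lemma clique_prob_ge:
  assumes S: "S \<subseteq> {..<n}" "S \<noteq> {}" and d: "1 \<le> d"
  shows "light_prob ^ card S * (light_factor / (2 ^ d * real n)) ^ (card S - 1) \<le> clique_prob n d S"
proof -
  obtain s where s: "s \<in> S" using S by auto
  have n: "n \<ge> 1" using S by (cases n) auto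
  \<comment> \<open>Half of the connection radius of two vertices of weight \<open>w0\<close>; the
    halving, needed for the triangle inequality, costs \<open>2 ^ d\<close> in volume per
    leaf.\<close>
  define \<rho> where "\<rho> = 1 / 4 * (lam * w0\<^sup>2 / real n) powr (1 / real d)"
  have \<rho>: "0 \<le> \<rho>" by (simp add: \<rho>_def)
  let ?N = "girg_measure n \<beta> w0 d"
  interpret N: prob_space ?N by (rule prob_space_girg)
  have "(2 * \<rho>) ^ d = (1 / 2) ^ d * ((lam * w0\<^sup>2 / real n) powr (1 / real d)) ^ d"
    unfolding \<rho>_def by (simp flip: power_mult_distrib)
  also have "\<dots> = lam * w0\<^sup>2 / (2 ^ d * real n)"
    using lam w0 d by (subst powr_root_power) (auto simp: power_divide)
  finally have pow: "(2 * \<rho>) ^ d = lam * w0\<^sup>2 / (2 ^ d * real n)" .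
  have "light_factor / (2 ^ d * real n) \<le> min 1 (2 * \<rho>) ^ d"
  proof (cases "2 * \<rho> \<le> 1")
    case True
    then have "min 1 (2 * \<rho>) ^ d = lam * w0\<^sup>2 / (2 ^ d * real n)" by (simp only: min_absorb2 pow)
    then show ?thesis by (simp add: light_factor_def divide_right_mono)
  next
    case False
    have "1 * 1 \<le> 2 ^ d * real n" using n by (intro mult_mono) auto
    then have "light_factor / (2 ^ d * real n) \<le> 1" using light_factor by (simp add: divide_le_eq)
    then show ?thesis using False by (simp add: min_absorb1)
  qed
  then have "light_prob * (light_factor / (2 ^ d * real n)) \<le> light_prob * min 1 (2 * \<rho>) ^ d"
    using light_prob by (intro mult_left_mono) auto
  then have bound: "ennreal (light_prob * (light_factor / (2 ^ d * real n)))
      \<le> emeasure (vertex_distr d) {y \<in> space (vertex_distr d). near d \<rho> x y}" if "light_vertex d x" for x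
    using emeasure_near_ge[OF \<rho> that] by (meson ennreal_leI order_trans)
  have clique: "light_clique n d S \<omega>"
    if \<omega>: "light_vertex d (\<omega> s)" "\<forall>v\<in>S - {s}. near d \<rho> (\<omega> s) (\<omega> v)" for \<omega>
  proof -
    \<comment> \<open>The centre is at distance 0 from itself, so pairs that involve it need no
      separate argument.\<close>
    have near: "near d \<rho> (\<omega> s) (\<omega> v)" if "v \<in> S" for v
      using that \<omega> \<rho> by (cases "v = s") (auto simp: near_def circle_dist_def)
    have "adjacent n d (\<omega> u) (\<omega> v)" if uv: "u \<in> S" "v \<in> S" for u v
      unfolding adjacent_def
    proof (intro allI impI)
      fix i assume i: "i < d"
      have "circle_dist (snd (\<omega> u) i) (snd (\<omega> v) i)
          \<le> circle_dist (snd (\<omega> s) i) (snd (\<omega> u) i) + circle_dist (snd (\<omega> s) i) (snd (\<omega> v) i)"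
        using near[OF uv(1)] near[OF uv(2)] i by (intro circle_dist_triangle) (auto simp: near_def light_vertex_def)
      also have "\<dots> \<le> 2 * \<rho>" using near[OF uv(1)] near[OF uv(2)] i
        unfolding near_def mult_2 by (intro add_mono) auto
      also have "\<dots> = 1 / 2 * (lam * w0\<^sup>2 / real n) powr (1 / real d)" by (simp add: \<rho>_def)
      also have "\<dots> \<le> 1 / 2 * (lam * fst (\<omega> u) * fst (\<omega> v) / real n) powr (1 / real d)"
      proof -
        have "w0 * w0 \<le> fst (\<omega> u) * fst (\<omega> v)"
          using near[OF uv(1)] near[OF uv(2)] w0 by (intro mult_mono) (auto simp: near_def light_vertex_def)
        then have "lam * w0\<^sup>2 / real n \<le> lam * fst (\<omega> u) * fst (\<omega> v) / real n"
          using lam by (intro divide_right_mono) (auto simp: power2_eq_square)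
        then show ?thesis using lam by (intro mult_left_mono powr_mono2) auto
      qed
      finally show "circle_dist (snd (\<omega> u) i) (snd (\<omega> v) i)
          \<le> 1 / 2 * (lam * fst (\<omega> u) * fst (\<omega> v) / real n) powr (1 / real d)" .
    qed
    then show ?thesis using near by (auto simp: light_clique_def near_def)
  qed
  \<comment> \<open>The centre contributes \<open>light_prob\<close> alone, each of the
    \<open>card S - 1\<close> leaves contributes \<open>light_prob\<close> times a volume.\<close>
  have "ennreal (light_prob ^ card S * (light_factor / (2 ^ d * real n)) ^ (card S - 1))
      = ennreal light_prob * ennreal (light_prob * (light_factor / (2 ^ d * real n))) ^ card (S - {s})"
  proof -
    let ?q = "light_factor / (2 ^ d * real n)"
    have card: "card S = Suc (card (S - {s}))"
      using finite_subset[OF S(1)] s by (intro card.remove) auto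
    have "0 \<le> light_prob * ?q" using light_prob(1) light_factor(1) by (intro mult_nonneg_nonneg) auto
    then have "ennreal light_prob * ennreal (light_prob * ?q) ^ card (S - {s})
        = ennreal (light_prob * (light_prob * ?q) ^ card (S - {s}))"
      using light_prob(1) by (simp only: ennreal_power ennreal_mult zero_le_power less_imp_le)
    also have "light_prob * (light_prob * ?q) ^ card (S - {s}) = light_prob ^ card S * ?q ^ (card S - 1)"
      unfolding card power_mult_distrib by simp
    finally show ?thesis by simp
  qed
  also have "\<dots> \<le> emeasure (vertex_distr d) {y \<in> space (vertex_distr d). light_vertex d y}
      * ennreal (light_prob * (light_factor / (2 ^ d * real n))) ^ card (S - {s})"
    by (intro mult_right_mono emeasure_light_vertex) auto
  also have "\<dots> \<le> emeasure ?N {\<omega> \<in> space ?N. light_vertex d (\<omega> s) \<and> (\<forall>v\<in>S - {s}. near d \<rho> (\<omega> s) (\<omega> v))}"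
    unfolding girg_measure_def using S s
    by (intro emeasure_PiM_star_ge prob_space_vertex_distr pred_light_vertex pred_near bound) auto
  also have "\<dots> \<le> emeasure ?N {\<omega> \<in> space ?N. light_clique n d S \<omega>}"
    using clique pred_light_clique[of "{..<n}" S n d] S
    by (intro emeasure_mono) (auto simp: girg_measure_def pred_def)
  also have "\<dots> = ennreal (clique_prob n d S)"
    by (simp add: clique_prob_def N.emeasure_eq_measure)
  finally show ?thesis by (simp add: clique_prob_def)
qed

text \<open>Of the second clique only the edges from a common vertex \<open>s\<close> to
  \<open>S' - S\<close> are kept. The first clique does not read the coordinates in
  \<open>S' - S\<close>, so the star bound applies with that clique as the predicate
  \<open>P\<close>.\<close>

lemma clique_prob_both_le:
  assumes S: "S \<subseteq> {..<n}" "S' \<subseteq> {..<n}" "S \<inter> S' \<noteq> {}" and d: "1 \<le> d"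
  shows "measure (girg_measure n \<beta> w0 d)
      {\<omega> \<in> space (girg_measure n \<beta> w0 d). light_clique n d S \<omega> \<and> light_clique n d S' \<omega>}
    \<le> clique_prob n d S * (lam * wc\<^sup>2 / real n) ^ card (S' - S)"
proof -
  obtain s where s: "s \<in> S" "s \<in> S'" using S by auto
  \<comment> \<open>The largest connection radius of two light vertices, reached at weight
    \<open>wc\<close> for both.\<close>
  define \<rho> where "\<rho> = 1 / 2 * (lam * wc\<^sup>2 / real n) powr (1 / real d)"
  have \<rho>: "0 \<le> \<rho>" by (simp add: \<rho>_def)
  let ?N = "girg_measure n \<beta> w0 d"
  interpret N: prob_space ?N by (rule prob_space_girg)
  have pow: "(2 * \<rho>) ^ d = lam * wc\<^sup>2 / real n"
    unfolding \<rho>_def using lam d by (simp add: powr_root_power)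
  have near: "near d \<rho> (\<omega> s) (\<omega> v)" if cl: "light_clique n d S' \<omega>" and v: "v \<in> S' - S" for \<omega> v
  proof -
    have l: "light_vertex d (\<omega> s)" "light_vertex d (\<omega> v)" and a: "adjacent n d (\<omega> s) (\<omega> v)"
      using cl s v by (auto simp: light_clique_def)
    have "fst (\<omega> s) * fst (\<omega> v) \<le> wc * wc"
      using l w0 by (intro mult_mono) (auto simp: light_vertex_def)
    then have "lam * fst (\<omega> s) * fst (\<omega> v) / real n \<le> lam * wc\<^sup>2 / real n"
      using lam by (intro divide_right_mono) (auto simp: power2_eq_square)
    moreover have "0 \<le> lam * fst (\<omega> s) * fst (\<omega> v) / real n"
      using l lam w0 by (auto simp: light_vertex_def)
    ultimately have "1 / 2 * (lam * fst (\<omega> s) * fst (\<omega> v) / real n) powr (1 / real d) \<le> \<rho>"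
      unfolding \<rho>_def by (intro mult_left_mono powr_mono2) auto
    then show ?thesis using l a by (fastforce simp: near_def adjacent_def)
  qed
  have cl[measurable]: "Measurable.pred ?N (light_clique n d S)"
    unfolding girg_measure_def using S by (intro pred_light_clique) auto
  have [measurable]: "Measurable.pred ?N (\<lambda>\<omega>. near d \<rho> (\<omega> s) (\<omega> v))" if "v \<in> S' - S" for v
  proof -
    have "(\<lambda>\<omega>. (\<omega> s, \<omega> v)) \<in> ?N \<rightarrow>\<^sub>M vertex_distr d \<Otimes>\<^sub>M vertex_distr d"
      unfolding girg_measure_def using that s S
      by (intro measurable_Pair measurable_component_singleton) auto
    from measurable_compose[OF this pred_near] show ?thesis by simp
  qed
  have fin: "finite (S' - S)" using S finite_subset by blast
  have "emeasure ?N {\<omega> \<in> space ?N. light_clique n d S \<omega> \<and> light_clique n d S' \<omega>}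
      \<le> emeasure ?N {\<omega> \<in> space ?N. light_clique n d S \<omega> \<and> (\<forall>v\<in>S' - S. near d \<rho> (\<omega> s) (\<omega> v))}"
  proof (intro emeasure_mono)
    have "Measurable.pred ?N (\<lambda>\<omega>. light_clique n d S \<omega> \<and> (\<forall>v\<in>S' - S. near d \<rho> (\<omega> s) (\<omega> v)))"
      using fin by (intro pred_intros_logic pred_intros_finite) auto
    then show "{\<omega> \<in> space ?N. light_clique n d S \<omega> \<and> (\<forall>v\<in>S' - S. near d \<rho> (\<omega> s) (\<omega> v))} \<in> sets ?N"
      by (simp add: pred_def)
  qed (use near in blast)
  also have "\<dots> \<le> emeasure ?N {\<omega> \<in> space ?N. light_clique n d S \<omega>} * ennreal ((2 * \<rho>) ^ d) ^ card (S' - S)"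
    unfolding girg_measure_def using S s \<rho>
    by (intro emeasure_PiM_star_le prob_space_vertex_distr pred_light_clique pred_near emeasure_near_le)
       (auto simp: light_clique_upd)
  also have "\<dots> = ennreal (clique_prob n d S * (lam * wc\<^sup>2 / real n) ^ card (S' - S))"
    unfolding pow using lam by (simp add: clique_prob_def N.emeasure_eq_measure ennreal_power ennreal_mult)
  finally show ?thesis
    using lam by (subst (asm) N.emeasure_eq_measure) (auto simp: clique_prob_def)
qed

end

section \<open>First and second moment of the clique count\<close>

lemma torus_dist_le_iff:
  assumes "1 \<le> d"
  shows "torus_dist d x y \<le> t \<longleftrightarrow> (\<forall>i<d. circle_dist (x i) (y i) \<le> t)"
proof -
  have "(\<lambda>i. circle_dist (x i) (y i)) ` {..<d} \<noteq> {}" using assms by (auto simp: lessThan_empty_iff)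
  then show ?thesis unfolding torus_dist_def by (subst Max_le_iff) auto
qed

abbreviation subsets_of_card :: "nat \<Rightarrow> nat \<Rightarrow> nat set set" where
  "subsets_of_card n k \<equiv> {S. S \<subseteq> {..<n} \<and> card S = k}"

lemma finite_subsets_of_card: "finite (subsets_of_card n k)"
  by (rule finite_subset[of _ "Pow {..<n}"]) auto

text \<open>Splitting \<open>S'\<close> into \<open>S' \<inter> S\<close> and \<open>S' - S\<close> turns the sum over all sets into a binomial expansion.\<close>

lemma sum_power_card_Diff_le:
  fixes x :: real
  assumes "0 \<le> x" "finite A" "S \<subseteq> A" "F \<subseteq> Pow A"
  shows "(\<Sum>S'\<in>F. x ^ card (S' - S)) \<le> 2 ^ card S * (1 + x) ^ card A"
proof -
  have fin: "finite S" using finite_subset[OF assms(3,2)] .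
  let ?f = "\<lambda>S'. (S' \<inter> S, S' - S)"
  have inj: "inj_on ?f F" by (rule inj_onI) blast
  have "(\<Sum>S'\<in>F. x ^ card (S' - S)) = (\<Sum>p\<in>?f ` F. x ^ card (snd p))"
    by (simp add: sum.reindex[OF inj])
  \<comment> \<open>The second component is relaxed from subsets of \<open>A - S\<close> to all
    subsets of \<open>A\<close>, and the restriction to \<open>F\<close> is dropped; all terms are
    nonnegative.\<close>
  also have "\<dots> \<le> (\<Sum>p\<in>Pow S \<times> Pow A. x ^ card (snd p))"
    using assms fin by (intro sum_mono2) auto
  also have "\<dots> = (\<Sum>U\<in>Pow S. \<Sum>T\<in>Pow A. x ^ card T)"
    by (simp only: sum.cartesian_product case_prod_unfold)
  also have "(\<Sum>T\<in>Pow A. x ^ card T) = (1 + x) ^ card A"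
  proof -
    have "(\<Prod>a\<in>A. x + 1) = (\<Sum>T\<in>Pow A. (\<Prod>a\<in>T. x) * (\<Prod>a\<in>A - T. 1))"
      using assms(2) by (rule prod_add)
    then show ?thesis by (simp add: add.commute)
  qed
  finally show ?thesis using fin by (simp add: card_Pow)
qed

context light_girg
begin

lemma adjacent_commute: "adjacent n d x y = adjacent n d y x"
  by (simp add: adjacent_def circle_dist_commute mult.commute mult.left_commute)

text \<open>An edge is an unordered pair, so its two representatives may come swapped; symmetry of
  \<open>adjacent\<close> resolves this.\<close>

lemma girg_edge_iff:
  assumes "1 \<le> d"
  shows "{u, v} \<in> snd (girg_graph lam n d \<omega>) \<longleftrightarrow> u < n \<and> v < n \<and> u \<noteq> v \<and> adjacent n d (\<omega> u) (\<omega> v)"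
proof -
  have "{u, v} \<in> snd (girg_graph lam n d \<omega>) \<longleftrightarrow>
      (\<exists>a b. {u, v} = {a, b} \<and> a < n \<and> b < n \<and> a \<noteq> b \<and> adjacent n d (\<omega> a) (\<omega> b))"
    unfolding girg_graph_def adjacent_def torus_dist_le_iff[OF assms] by simp
  also have "\<dots> \<longleftrightarrow> u < n \<and> v < n \<and> u \<noteq> v \<and> adjacent n d (\<omega> u) (\<omega> v)"
    using adjacent_commute[of n d "\<omega> u" "\<omega> v"] by (auto simp: doubleton_eq_iff)
  finally show ?thesis .
qed

text \<open>Holds for every sample, as measurability of the count requires; hence the bare weight
  bound in place of \<open>light_vertex\<close>.\<close>

lemma light_clique_count_eq:
  assumes "1 \<le> d"
  shows "light_clique_count lam n d wc k \<omega> = (\<Sum>S\<in>subsets_of_card n k.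
    of_bool ((\<forall>v\<in>S. fst (\<omega> v) \<le> wc) \<and> (\<forall>u\<in>S. \<forall>v\<in>S. u \<noteq> v \<longrightarrow> adjacent n d (\<omega> u) (\<omega> v))))"
proof -
  let ?P = "\<lambda>S. (\<forall>v\<in>S. fst (\<omega> v) \<le> wc) \<and> (\<forall>u\<in>S. \<forall>v\<in>S. u \<noteq> v \<longrightarrow> adjacent n d (\<omega> u) (\<omega> v))"
  have "S \<in> cliques k (induced_subgraph (girg_graph lam n d \<omega>) {v. vertex_weight \<omega> v \<le> wc})
      \<longleftrightarrow> S \<in> subsets_of_card n k \<inter> {S. ?P S}" for S
  proof -
    have "S \<in> cliques k (induced_subgraph (girg_graph lam n d \<omega>) {v. vertex_weight \<omega> v \<le> wc})
      \<longleftrightarrow> S \<subseteq> {..<n} \<inter> {v. fst (\<omega> v) \<le> wc} \<and> card S = k \<and>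
        (\<forall>u\<in>S. \<forall>v\<in>S. u \<noteq> v \<longrightarrow> {u, v} \<in> snd (girg_graph lam n d \<omega>) \<and> {u, v} \<subseteq> {v. fst (\<omega> v) \<le> wc})"
      by (simp add: cliques_def induced_subgraph_def girg_graph_def)
    also have "\<dots> \<longleftrightarrow> S \<in> subsets_of_card n k \<inter> {S. ?P S}"
      unfolding girg_edge_iff[OF assms] by blast
    finally show ?thesis .
  qed
  then have "cliques k (induced_subgraph (girg_graph lam n d \<omega>) {v. vertex_weight \<omega> v \<le> wc})
      = subsets_of_card n k \<inter> {S. ?P S}" by blast
  then show ?thesis
    unfolding light_clique_count_def using finite_subsets_of_card[of n k]
    by (subst sum_of_bool_eq) simp_all
qed

section \<open>The count as a sum of indicators of events, and its mean\<close>

abbreviation clique_event :: "nat \<Rightarrow> nat \<Rightarrow> nat set \<Rightarrow> girg_sample set" where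
  "clique_event n d S \<equiv> {\<omega> \<in> space (girg_measure n \<beta> w0 d). light_clique n d S \<omega>}"

lemma sets_clique_event: "S \<subseteq> {..<n} \<Longrightarrow> clique_event n d S \<in> sets (girg_measure n \<beta> w0 d)"
  using pred_light_clique[of "{..<n}" S n d] unfolding girg_measure_def pred_def by auto

lemma light_clique_count_measurable:
  assumes "1 \<le> d"
  shows "light_clique_count lam n d wc k \<in> borel_measurable (girg_measure n \<beta> w0 d)"
proof -
  have w: "Measurable.pred (vertex_distr d) (\<lambda>y. fst y \<le> wc)"
    using weight_measurable by measurable
  have "(\<lambda>\<omega>. of_bool ((\<forall>v\<in>S. fst (\<omega> v) \<le> wc) \<and>
      (\<forall>u\<in>S. \<forall>v\<in>S. u \<noteq> v \<longrightarrow> adjacent n d (\<omega> u) (\<omega> v))) :: real)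
      \<in> borel_measurable (girg_measure n \<beta> w0 d)" if "S \<in> subsets_of_card n k" for S
  proof -
    have "Measurable.pred (girg_measure n \<beta> w0 d) (\<lambda>\<omega>. (\<forall>v\<in>S. fst (\<omega> v) \<le> wc) \<and>
        (\<forall>u\<in>S. \<forall>v\<in>S. u \<noteq> v \<longrightarrow> adjacent n d (\<omega> u) (\<omega> v)))"
      unfolding girg_measure_def using that by (intro pred_clique_of w) auto
    then show ?thesis by (rule measurable_compose) simp
  qed
  then show ?thesis
    unfolding light_clique_count_eq[OF assms, abs_def] by (intro borel_measurable_sum)
qed

text \<open>Off the null set of \<open>AE_girg\<close> the extra support conditions in
  \<open>light_clique\<close> hold by themselves.\<close>

lemma AE_light_clique_count:
  assumes "1 \<le> d"
  shows "AE \<omega> in girg_measure n \<beta> w0 d. light_clique_count lam n d wc k \<omega>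
    = (\<Sum>S\<in>subsets_of_card n k. indicator (clique_event n d S) \<omega>)"
  using AE_girg AE_space
proof eventually_elim
  case (elim \<omega>)
  have "((\<forall>v\<in>S. fst (\<omega> v) \<le> wc) \<and> (\<forall>u\<in>S. \<forall>v\<in>S. u \<noteq> v \<longrightarrow> adjacent n d (\<omega> u) (\<omega> v)))
      \<longleftrightarrow> \<omega> \<in> clique_event n d S" if "S \<in> subsets_of_card n k" for S
    using elim that by (auto simp: light_clique_def light_vertex_def subset_iff)
  then show ?case
    unfolding light_clique_count_eq[OF assms] by (intro sum.cong) (auto simp: indicator_def)
qed

lemma expected_cliques_eq:
  assumes "1 \<le> d"
  shows "expected_cliques lam \<beta> w0 n d wc k = (\<Sum>S\<in>subsets_of_card n k. clique_prob n d S)"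
proof -
  interpret N: prob_space "girg_measure n \<beta> w0 d" by (rule prob_space_girg)
  have "expected_cliques lam \<beta> w0 n d wc k
     = N.expectation (\<lambda>\<omega>. \<Sum>S\<in>subsets_of_card n k. indicator (clique_event n d S) \<omega>)"
    unfolding expected_cliques_def
    by (intro integral_cong_AE light_clique_count_measurable AE_light_clique_count assms
        borel_measurable_sum borel_measurable_indicator sets_clique_event) auto
  also have "\<dots> = (\<Sum>S\<in>subsets_of_card n k. N.expectation (indicator (clique_event n d S)))"
    by (intro Bochner_Integration.integral_sum integrable_real_indicator sets_clique_event)
       (auto simp: N.emeasure_eq_measure)
  also have "\<dots> = (\<Sum>S\<in>subsets_of_card n k. clique_prob n d S)"
    by (intro sum.cong refl) (simp add: clique_prob_def Int_absorb2 Collect_restrict)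
  finally show ?thesis .
qed

text \<open>Independence amounts to the joint law being the product of the marginals; here both are
  the product measure itself.\<close>

lemma indep_vars_coordinates:
  assumes "0 < n"
  shows "prob_space.indep_vars (girg_measure n \<beta> w0 d) (\<lambda>_. vertex_distr d) (\<lambda>v \<omega>. \<omega> v) {..<n}"
proof -
  let ?N = "girg_measure n \<beta> w0 d"
  interpret N: prob_space ?N by (rule prob_space_girg)
  have comp: "(\<lambda>\<omega>. \<omega> v) \<in> ?N \<rightarrow>\<^sub>M vertex_distr d" if "v \<in> {..<n}" for v
    unfolding girg_measure_def using that by (intro measurable_component_singleton)
  have "distr ?N (PiM {..<n} (\<lambda>_. vertex_distr d)) (\<lambda>\<omega>. \<lambda>v\<in>{..<n}. \<omega> v) = distr ?N ?N (\<lambda>\<omega>. \<omega>)"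
    unfolding girg_measure_def
    by (intro distr_cong) (auto simp: space_PiM PiE_iff extensional_restrict)
  also have "\<dots> = ?N" by (rule distr_id)
  also have "\<dots> = PiM {..<n} (\<lambda>v. distr ?N (vertex_distr d) (\<lambda>\<omega>. \<omega> v))"
    unfolding girg_measure_def
    by (intro PiM_cong refl, subst distr_PiM_component) (auto intro: prob_space_vertex_distr)
  finally show ?thesis
    using assms by (subst N.indep_vars_iff_distr_eq_PiM') (auto intro!: comp)
qed

text \<open>Each event is a function of the sample restricted to its own vertex set, and
  restrictions to disjoint sets of independent coordinates are independent.\<close>

lemma measure_clique_event_disjoint:
  assumes S: "S \<subseteq> {..<n}" "S' \<subseteq> {..<n}" and disj: "S \<inter> S' = {}" and n: "0 < n"
  shows "measure (girg_measure n \<beta> w0 d) (clique_event n d S \<inter> clique_event n d S')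
    = clique_prob n d S * clique_prob n d S'"
proof -
  let ?N = "girg_measure n \<beta> w0 d"
  let ?C = "\<lambda>S. {\<omega> \<in> space (PiM S (\<lambda>_. vertex_distr d)). light_clique n d S \<omega>}"
  interpret N: prob_space ?N by (rule prob_space_girg)
  have sets: "?C S \<in> sets (PiM S (\<lambda>_. vertex_distr d))" if "S \<subseteq> {..<n}" for S
    using pred_light_clique[of S S n d] finite_subset[OF that] by (simp add: pred_def)
  have vimage: "(\<lambda>\<omega>. restrict (\<lambda>i. \<omega> i) S) -` ?C S \<inter> space ?N = clique_event n d S"
    if "S \<subseteq> {..<n}" for S
    using that by (auto simp: light_clique_restrict girg_measure_def space_PiM PiE_iff extensional_def)
  have "N.prob ((\<lambda>x. (restrict (\<lambda>i. x i) S, restrict (\<lambda>i. x i) S')) -` (?C S \<times> ?C S') \<inter> space ?N)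
     = N.prob ((\<lambda>x. restrict (\<lambda>i. x i) S) -` ?C S \<inter> space ?N)
       * N.prob ((\<lambda>x. restrict (\<lambda>i. x i) S') -` ?C S' \<inter> space ?N)"
    by (intro N.indep_varD[OF N.indep_var_restrict[OF indep_vars_coordinates]] n disj S sets)
  also have "(\<lambda>x. (restrict (\<lambda>i. x i) S, restrict (\<lambda>i. x i) S')) -` (?C S \<times> ?C S') \<inter> space ?N
     = ((\<lambda>x. restrict (\<lambda>i. x i) S) -` ?C S \<inter> space ?N) \<inter> ((\<lambda>x. restrict (\<lambda>i. x i) S') -` ?C S' \<inter> space ?N)"
    by blast
  finally show ?thesis unfolding vimage[OF S(1)] vimage[OF S(2)] clique_prob_def .
qed

lemma variance_cliques_le:
  assumes d: "1 \<le> d" and n: "0 < n"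
  shows "variance_cliques lam \<beta> w0 n d wc k
    \<le> 2 ^ k * exp (lam * wc\<^sup>2) * expected_cliques lam \<beta> w0 n d wc k"
proof -
  let ?N = "girg_measure n \<beta> w0 d" and ?A = "subsets_of_card n k"
  interpret N: prob_space ?N by (rule prob_space_girg)
  \<comment> \<open>An almost surely equal version of the count; the variance does not see the
    difference.\<close>
  define X :: "girg_sample \<Rightarrow> real" where "X = (\<lambda>\<omega>. \<Sum>S\<in>?A. indicator (clique_event n d S) \<omega>)"
  define x where "x = lam * wc\<^sup>2 / real n"
  have x: "0 \<le> x" using lam by (simp add: x_def)
  have meas[measurable]: "X \<in> borel_measurable ?N"
    unfolding X_def by (intro borel_measurable_sum borel_measurable_indicator sets_clique_event) auto
  have AE: "AE \<omega> in ?N. light_clique_count lam n d wc k \<omega> = X \<omega>"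
    unfolding X_def using d by (rule AE_light_clique_count)
  have int: "integrable ?N (indicator (clique_event n d S) :: _ \<Rightarrow> real)" if "S \<in> ?A" for S
    using that by (intro integrable_real_indicator sets_clique_event) (auto simp: N.emeasure_eq_measure)
  have int2: "integrable ?N (indicator (clique_event n d S \<inter> clique_event n d S') :: _ \<Rightarrow> real)"
    if "S \<in> ?A" "S' \<in> ?A" for S S'
    using that by (intro integrable_real_indicator sets.Int sets_clique_event) (auto simp: N.emeasure_eq_measure)
  have X2: "(\<lambda>\<omega>. (X \<omega>)\<^sup>2) = (\<lambda>\<omega>. \<Sum>S\<in>?A. \<Sum>S'\<in>?A. indicator (clique_event n d S \<inter> clique_event n d S') \<omega>)"
    unfolding X_def power2_eq_square sum_product by (simp add: indicator_inter_arith)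
  have EX: "N.expectation X = (\<Sum>S\<in>?A. clique_prob n d S)"
  proof -
    have "N.expectation X = expected_cliques lam \<beta> w0 n d wc k"
      unfolding expected_cliques_def using AE d
      by (intro integral_cong_AE light_clique_count_measurable meas) auto
    then show ?thesis using d by (simp add: expected_cliques_eq)
  qed
  have "variance_cliques lam \<beta> w0 n d wc k = N.variance X"
  proof -
    have "N.expectation (light_clique_count lam n d wc k) = N.expectation X"
      using AE d by (intro integral_cong_AE light_clique_count_measurable meas) auto
    then show ?thesis
      unfolding variance_cliques_def
      using AE light_clique_count_measurable[OF d]
      by (intro integral_cong_AE) auto
  qed
  also have "\<dots> = N.expectation (\<lambda>\<omega>. (X \<omega>)\<^sup>2) - (N.expectation X)\<^sup>2"
  proof (rule N.variance_eq)
    show "integrable ?N X" unfolding X_def by (intro Bochner_Integration.integrable_sum int)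
    show "integrable ?N (\<lambda>\<omega>. (X \<omega>)\<^sup>2)" unfolding X2 by (intro Bochner_Integration.integrable_sum int2)
  qed
  also have "N.expectation (\<lambda>\<omega>. (X \<omega>)\<^sup>2)
      = (\<Sum>S\<in>?A. \<Sum>S'\<in>?A. measure ?N (clique_event n d S \<inter> clique_event n d S'))"
  proof -
    have "N.expectation (\<lambda>\<omega>. (X \<omega>)\<^sup>2) = (\<Sum>S\<in>?A. N.expectation (\<lambda>\<omega>. \<Sum>S'\<in>?A.
        indicator (clique_event n d S \<inter> clique_event n d S') \<omega>))"
      unfolding X2 by (intro Bochner_Integration.integral_sum Bochner_Integration.integrable_sum int2)
    also have "\<dots> = (\<Sum>S\<in>?A. \<Sum>S'\<in>?A. N.expectation (indicator (clique_event n d S \<inter> clique_event n d S')))"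
      by (intro sum.cong refl Bochner_Integration.integral_sum int2)
    also have "\<dots> = (\<Sum>S\<in>?A. \<Sum>S'\<in>?A. measure ?N (clique_event n d S \<inter> clique_event n d S'))"
      by (intro sum.cong refl) (auto intro!: arg_cong[where f = "measure ?N"])
    finally show ?thesis .
  qed
  also have "(N.expectation X)\<^sup>2 = (\<Sum>S\<in>?A. \<Sum>S'\<in>?A. clique_prob n d S * clique_prob n d S')"
    by (simp only: EX power2_eq_square sum_product)
  also have "(\<Sum>S\<in>?A. \<Sum>S'\<in>?A. measure ?N (clique_event n d S \<inter> clique_event n d S'))
      - (\<Sum>S\<in>?A. \<Sum>S'\<in>?A. clique_prob n d S * clique_prob n d S')
      = (\<Sum>S\<in>?A. \<Sum>S'\<in>?A. measure ?N (clique_event n d S \<inter> clique_event n d S')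
          - clique_prob n d S * clique_prob n d S')"
    by (simp only: sum_subtractf)
  \<comment> \<open>Disjoint pairs have covariance 0, so the bound for overlapping pairs holds for
    all pairs and the inner sum need not be restricted.\<close>
  also have "\<dots> \<le> (\<Sum>S\<in>?A. \<Sum>S'\<in>?A. clique_prob n d S * x ^ card (S' - S))"
  proof (intro sum_mono)
    fix S S' assume S: "S \<in> ?A" "S' \<in> ?A"
    have nonneg: "0 \<le> clique_prob n d T" for T by (simp add: clique_prob_def)
    show "measure ?N (clique_event n d S \<inter> clique_event n d S') - clique_prob n d S * clique_prob n d S'
        \<le> clique_prob n d S * x ^ card (S' - S)"
    proof (cases "S \<inter> S' = {}")
      case True
      then show ?thesis using S n x nonneg by (simp add: measure_clique_event_disjoint)
    next
      case False
      have "clique_event n d S \<inter> clique_event n d S'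
          = {\<omega> \<in> space ?N. light_clique n d S \<omega> \<and> light_clique n d S' \<omega>}" by blast
      then have "measure ?N (clique_event n d S \<inter> clique_event n d S') \<le> clique_prob n d S * x ^ card (S' - S)"
        unfolding x_def using clique_prob_both_le[of S n S' d] S False d by simp
      moreover have "0 \<le> clique_prob n d S * clique_prob n d S'"
        by (intro mult_nonneg_nonneg nonneg)
      ultimately show ?thesis by linarith
    qed
  qed
  also have "\<dots> = (\<Sum>S\<in>?A. clique_prob n d S * (\<Sum>S'\<in>?A. x ^ card (S' - S)))"
    by (simp only: sum_distrib_left)
  also have "\<dots> \<le> (\<Sum>S\<in>?A. clique_prob n d S * (2 ^ k * exp (lam * wc\<^sup>2)))"
  proof (intro sum_mono mult_left_mono)
    fix S assume S: "S \<in> ?A"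
    have "(\<Sum>S'\<in>?A. x ^ card (S' - S)) \<le> 2 ^ card S * (1 + x) ^ card {..<n}"
      using S x by (intro sum_power_card_Diff_le) auto
    \<comment> \<open>Since \<open>1 + x \<le> exp x\<close> and \<open>x\<close> carries a factor
      \<open>1 / n\<close>, the power stays bounded in \<open>n\<close>.\<close>
    also have "(1 + x) ^ card {..<n} \<le> exp x ^ n"
      using x by (simp add: power_mono)
    also have "exp x ^ n = exp (lam * wc\<^sup>2)"
      using n by (simp add: x_def flip: exp_of_nat_mult)
    finally show "(\<Sum>S'\<in>?A. x ^ card (S' - S)) \<le> 2 ^ k * exp (lam * wc\<^sup>2)" using S by simp
  qed (simp add: clique_prob_def)
  also have "\<dots> = 2 ^ k * exp (lam * wc\<^sup>2) * expected_cliques lam \<beta> w0 n d wc k"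
    using d by (simp add: expected_cliques_eq sum_distrib_left mult.commute)
  finally show ?thesis .
qed

text \<open>There are at least \<open>(n / k) ^ k\<close> candidate sets, while a star has only
  \<open>k - 1\<close> leaves, each costing a factor \<open>1 / n\<close>; this leaves one factor
  \<open>n\<close>.\<close>

lemma expected_cliques_ge:
  assumes d: "1 \<le> d" and k: "1 \<le> k" "k \<le> n"
  shows "real n * (1 / (light_prob * light_factor) * 2 ^ d * real k) powr (- real k)
    \<le> expected_cliques lam \<beta> w0 n d wc k"
proof -
  define p m where "p = light_prob" and "m = light_factor"
  have pm: "0 < p" "0 < m" "m \<le> 1" using light_prob light_factor by (auto simp: p_def m_def)
  have n: "0 < n" using k by simp
  obtain j where j: "k = Suc j" using k by (cases k) auto
  have pos: "0 < 1 / (p * m) * 2 ^ d * real k" using pm k by simp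
  have "real n * (1 / (p * m) * 2 ^ d * real k) powr (- real k)
      = real n * (p * m / (2 ^ d * real k)) ^ k"
    using pos by (simp add: powr_minus powr_realpow power_divide power_mult_distrib field_simps)
  \<comment> \<open>One factor \<open>m / 2 ^ d\<close>, which is at most 1, is given up so that the
    final bound is a pure \<open>k\<close>-th power.\<close>
  also have "\<dots> \<le> real n * (p ^ k * (m / 2 ^ d) ^ j / real k ^ k)"
  proof -
    have "(m / 2 ^ d) ^ k \<le> (m / 2 ^ d) ^ j"
      unfolding j using pm by (intro power_decreasing) (auto simp: divide_le_eq intro: order_trans[OF _ one_le_power])
    then have "real n * (p ^ k * (m / 2 ^ d) ^ k / real k ^ k) \<le> real n * (p ^ k * (m / 2 ^ d) ^ j / real k ^ k)"
      using pm by (intro mult_left_mono divide_right_mono) auto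
    moreover have "(p * m / (2 ^ d * real k)) ^ k = p ^ k * (m / 2 ^ d) ^ k / real k ^ k"
      by (simp add: power_divide power_mult_distrib)
    ultimately show ?thesis by (simp only:)
  qed
  also have "\<dots> = (real n / real k) ^ k * (p ^ k * (m / (2 ^ d * real n)) ^ j)"
    using n k by (simp add: j power_divide power_mult_distrib field_simps)
  also have "\<dots> \<le> real (n choose k) * (p ^ k * (m / (2 ^ d * real n)) ^ j)"
    using k pm by (intro mult_right_mono binomial_ge_n_over_k_pow_k) auto
  also have "\<dots> = (\<Sum>S\<in>subsets_of_card n k. p ^ k * (m / (2 ^ d * real n)) ^ j)"
    using n_subsets[of "{..<n}" k] by simp
  also have "\<dots> \<le> (\<Sum>S\<in>subsets_of_card n k. clique_prob n d S)"
  proof (intro sum_mono)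
    fix S assume S: "S \<in> subsets_of_card n k"
    then have "S \<noteq> {}" using j by auto
    with S show "p ^ k * (m / (2 ^ d * real n)) ^ j \<le> clique_prob n d S"
      using clique_prob_ge[of S n d] d j by (auto simp: p_def m_def)
  qed
  also have "\<dots> = expected_cliques lam \<beta> w0 n d wc k" using d by (simp add: expected_cliques_eq)
  finally show ?thesis by (simp only: p_def m_def)
qed

end

section \<open>The clique threshold\<close>

text \<open>Taking logarithms of the defining equation gives \<open>ln z = W + ln W\<close>. From
  \<open>z = exp 1\<close> on, \<open>W \<ge> 1\<close>, so \<open>ln W\<close> lies between 0 and
  \<open>W - 1\<close>, which places \<open>W\<close> between \<open>ln z / 2\<close> and
  \<open>ln z\<close>.\<close>

lemma lambert_W_bounds:
  assumes "exp 1 \<le> z"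
  shows "1 \<le> lambert_W z" "ln z / 2 \<le> lambert_W z" "lambert_W z \<le> ln z"
    "exp (lambert_W z) = z / lambert_W z"
proof -
  have z: "0 < z" using assms exp_gt_zero[of "1 :: real"] by linarith
  then have "- exp (- 1) \<le> z" using exp_gt_zero[of "- 1 :: real"] by linarith
  then have W: "- 1 \<le> lambert_W z" "lambert_W z * exp (lambert_W z) = z" by (rule lambert_W_props)+
  have pos: "0 < lambert_W z" using W z by (metis exp_gt_zero zero_less_mult_pos2)
  show 1: "1 \<le> lambert_W z"
  proof (rule ccontr)
    assume "\<not> 1 \<le> lambert_W z"
    then have "lambert_W z * exp (lambert_W z) < 1 * exp 1"
      using pos by (intro mult_strict_mono) auto
    then show False using W assms by simp
  qed
  have ln: "ln z = ln (lambert_W z) + lambert_W z"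
    using W(2) pos by (metis exp_gt_zero exp_not_eq_zero ln_exp ln_mult_pos)
  show "lambert_W z \<le> ln z" using ln 1 by simp
  show "ln z / 2 \<le> lambert_W z" using ln ln_le_minus_one[OF pos] by simp
  show "exp (lambert_W z) = z / lambert_W z" using W(2) pos by (simp add: field_simps)
qed

lemma clique_threshold_arg_eq:
  "0 < n \<Longrightarrow> clique_threshold_arg c1 \<epsilon> n d = 2 ^ d * c1 * ((1 - \<epsilon>) * ln (real n))"
  by (simp add: clique_threshold_arg_def ln_powr)

text \<open>Rewriting \<open>exp W\<close> as \<open>z / W\<close> cancels the prefactor, and the
  dimension then enters only through \<open>W\<close>.\<close>

lemma clique_threshold_eq:
  assumes "0 < c1" "0 < n" "exp 1 \<le> clique_threshold_arg c1 \<epsilon> n d"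
  shows "clique_threshold c1 \<epsilon> n d = (1 - \<epsilon>) * ln (real n) / lambert_W (clique_threshold_arg c1 \<epsilon> n d)"
  using assms(1) unfolding clique_threshold_def lambert_W_bounds(4)[OF assms(3)]
  by (simp add: clique_threshold_arg_eq[OF assms(2)])

text \<open>Uniform in the dimension: \<open>2 ^ d\<close> is at least 1 and the remaining factor
  tends to infinity.\<close>

lemma eventually_clique_threshold_arg_ge:
  assumes "0 < c1" "\<epsilon> < 1"
  shows "\<forall>\<^sub>F n in sequentially. K \<le> clique_threshold_arg c1 \<epsilon> n (d n)"
proof -
  have "filterlim (\<lambda>n. c1 * ((1 - \<epsilon>) * ln (real n))) at_top sequentially"
    using assms by real_asymp
  then have "\<forall>\<^sub>F n in sequentially. K \<le> c1 * ((1 - \<epsilon>) * ln (real n))"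
    by (simp add: filterlim_at_top)
  then show ?thesis using eventually_gt_at_top[of 0]
  proof eventually_elim
    case (elim n)
    have "1 * (c1 * ((1 - \<epsilon>) * ln (real n))) \<le> 2 ^ d n * (c1 * ((1 - \<epsilon>) * ln (real n)))"
      using assms elim by (intro mult_right_mono) auto
    then show ?case using elim by (simp add: clique_threshold_arg_eq mult.assoc)
  qed
qed

lemma clique_threshold_bigtheta:
  assumes c1: "0 < c1" and \<epsilon>: "\<epsilon> < 1"
  shows "(\<lambda>n. clique_threshold c1 \<epsilon> n (d n)) \<in> \<Theta>(\<lambda>n. ln (real n) / (real (d n) + ln (ln (real n))))"
proof -
  \<comment> \<open>The constant part of the logarithm of the argument, which is
    \<open>d ln 2 + a + ln ln n\<close>; it is absorbed once \<open>ln ln n\<close> exceeds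
    \<open>2 * \<bar>a\<bar>\<close>.\<close>
  define a where "a = ln (c1 * (1 - \<epsilon>))"
  have "filterlim (\<lambda>n. ln (ln (real n))) at_top sequentially" by real_asymp
  then have "\<forall>\<^sub>F n in sequentially. max 1 (2 * \<bar>a\<bar>) \<le> ln (ln (real n))"
    by (simp only: filterlim_at_top)
  moreover have "\<forall>\<^sub>F n in sequentially. 1 < ln (real n)" by real_asymp
  moreover note eventually_clique_threshold_arg_ge[OF c1 \<epsilon>, of "exp 1" d] eventually_gt_at_top[of 0]
  ultimately have ev: "\<forall>\<^sub>F n in sequentially.
      (1 - \<epsilon>) / 2 * norm (ln (real n) / (real (d n) + ln (ln (real n)))) \<le> norm (clique_threshold c1 \<epsilon> n (d n)) \<and>
      norm (clique_threshold c1 \<epsilon> n (d n)) \<le> 4 * (1 - \<epsilon>) * norm (ln (real n) / (real (d n) + ln (ln (real n))))"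
  proof eventually_elim
    case (elim n)
    define W D where "W = lambert_W (clique_threshold_arg c1 \<epsilon> n (d n))" and "D = real (d n) + ln (ln (real n))"
    have L: "1 \<le> ln (ln (real n))" "\<bar>a\<bar> \<le> ln (ln (real n)) / 2" using elim(1) by simp_all
    have D: "0 < D" using L by (simp add: D_def)
    have thr: "clique_threshold c1 \<epsilon> n (d n) = (1 - \<epsilon>) * ln (real n) / W"
      unfolding W_def using c1 elim by (intro clique_threshold_eq)
    define u where "u = real (d n) * ln 2"
    have "ln (clique_threshold_arg c1 \<epsilon> n (d n)) = u + a + ln (ln (real n))"
    proof -
      have "clique_threshold_arg c1 \<epsilon> n (d n) = 2 ^ d n * ((c1 * (1 - \<epsilon>)) * ln (real n))"
        using elim by (simp add: clique_threshold_arg_eq)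
      then show ?thesis using c1 \<epsilon> elim(2) by (simp add: ln_mult_pos ln_realpow a_def u_def)
    qed
    moreover have "real (d n) * (1 / 2) \<le> u" "u \<le> real (d n) * 1"
      unfolding u_def using ln2_ge_two_thirds ln_2_less_1 by (intro mult_left_mono; simp)+
    ultimately have "D / 2 \<le> ln (clique_threshold_arg c1 \<epsilon> n (d n))"
      "ln (clique_threshold_arg c1 \<epsilon> n (d n)) \<le> 2 * D"
      using L unfolding D_def abs_le_iff by simp_all
    then have W: "D / 4 \<le> W" "W \<le> 2 * D" "0 < W"
      using lambert_W_bounds[OF elim(3)] unfolding W_def by - linarith+
    have num: "0 \<le> (1 - \<epsilon>) * ln (real n)" using \<epsilon> elim by simp
    have "(1 - \<epsilon>) * ln (real n) / (2 * D) \<le> (1 - \<epsilon>) * ln (real n) / W"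
      using W D num by (intro divide_left_mono) auto
    moreover have "(1 - \<epsilon>) * ln (real n) / W \<le> (1 - \<epsilon>) * ln (real n) / (D / 4)"
      using W D num by (intro divide_left_mono) auto
    ultimately show ?case
      using W D num elim(2) unfolding thr D_def[symmetric] by (simp add: abs_of_nonneg field_simps)
  qed
  show ?thesis
    by (rule bigthetaI'[of "(1 - \<epsilon>) / 2" "4 * (1 - \<epsilon>)"]) (use \<epsilon> ev in auto)
qed

text \<open>The argument is not positive, so \<open>W \<le> 0\<close> and the prefactor alone pushes
  the threshold below 1. Hence no \<open>k \<ge> 1\<close> is admissible when
  \<open>\<epsilon> \<ge> 1\<close>.\<close>

lemma clique_threshold_lt_1:
  assumes "1 \<le> c1" "1 \<le> \<epsilon>" "0 < n" "1 \<le> d" "- exp (- 1) \<le> clique_threshold_arg c1 \<epsilon> n d"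
  shows "clique_threshold c1 \<epsilon> n d < 1"
proof -
  let ?z = "clique_threshold_arg c1 \<epsilon> n d"
  have "(1 - \<epsilon>) * ln (real n) \<le> 0" using assms by (intro mult_nonpos_nonneg) auto
  then have "?z \<le> 0"
    unfolding clique_threshold_arg_eq[OF assms(3)] using assms(1)
    by (intro mult_nonneg_nonpos[of "2 ^ d * c1"]) auto
  then have "lambert_W ?z * exp (lambert_W ?z) \<le> 0" by (simp only: lambert_W_props(2)[OF assms(5)])
  then have "lambert_W ?z \<le> 0" by (simp add: mult_le_0_iff not_le[symmetric])
  then have "exp (lambert_W ?z) \<le> 1" by simp
  also have "1 < 2 ^ d * c1"
  proof -
    have "1 < (2 :: real) ^ d" using assms(4) by (intro one_less_power) auto
    then show ?thesis using assms(1) by (metis less_le_trans mult.right_neutral mult_left_mono less_eq_real_def less_trans zero_less_one)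
  qed
  finally show ?thesis
    unfolding clique_threshold_def using assms(1) by (simp add: divide_less_eq)
qed

text \<open>The bound on \<open>k\<close> enters twice: it gives
  \<open>ln (c1 * 2 ^ d * k) \<le> W\<close>, and then \<open>k * W\<close> is at most the threshold
  times \<open>W\<close>, which is \<open>(1 - \<epsilon>) * ln n\<close>.\<close>

lemma powr_le_below_clique_threshold:
  assumes c1: "1 \<le> c1" and n: "0 < n" and k: "1 \<le> k" "real k \<le> clique_threshold c1 \<epsilon> n d"
    and arg: "exp 1 \<le> clique_threshold_arg c1 \<epsilon> n d"
  shows "real n powr \<epsilon> \<le> real n * (c1 * 2 ^ d * real k) powr (- real k)"
proof -
  define W B where "W = lambert_W (clique_threshold_arg c1 \<epsilon> n d)" and "B = c1 * 2 ^ d * real k"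
  have W: "1 \<le> W" unfolding W_def using arg by (rule lambert_W_bounds)
  have B: "0 < B" using c1 k by (simp add: B_def)
  have "B \<le> exp W"
    using k(2) c1 unfolding clique_threshold_def W_def[symmetric] B_def by (simp add: field_simps)
  then have lnB: "ln B \<le> W" using B by (metis exp_gt_zero ln_exp ln_le_cancel_iff)
  have "real k * ln B \<le> real k * W" using lnB by (intro mult_left_mono) auto
  also have "\<dots> \<le> clique_threshold c1 \<epsilon> n d * W" using k(2) W by (intro mult_right_mono) auto
  also have "\<dots> = (1 - \<epsilon>) * ln (real n)"
    using clique_threshold_eq[OF _ n arg] c1 W unfolding W_def[symmetric] by simp
  finally have *: "real k * ln B \<le> (1 - \<epsilon>) * ln (real n)" .
  have "real n powr \<epsilon> = exp (\<epsilon> * ln (real n))" using n by (simp add: powr_def)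
  also have "\<dots> \<le> exp (ln (real n) + (- real k) * ln B)" using * by (simp add: algebra_simps)
  also have "\<dots> = real n * B powr (- real k)" using n B by (simp add: exp_diff exp_minus powr_def divide_inverse)
  finally show ?thesis by (simp only: B_def)
qed

text \<open>A large argument forces \<open>W \<ge> K\<close>. As \<open>K\<close> is arbitrary,
  admissible \<open>k\<close> are \<open>o(log n)\<close> regardless of the dimension.\<close>

lemma clique_threshold_le:
  assumes "0 < c1" "0 < n" "0 < \<epsilon>" "0 < K" "exp (2 * K) \<le> clique_threshold_arg c1 \<epsilon> n d"
    "exp 1 \<le> clique_threshold_arg c1 \<epsilon> n d"
  shows "clique_threshold c1 \<epsilon> n d \<le> ln (real n) / K"
proof -
  let ?z = "clique_threshold_arg c1 \<epsilon> n d"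
  have "ln (exp (2 * K)) \<le> ln ?z" using assms(5) by (subst ln_le_cancel_iff) (auto intro: less_le_trans[OF exp_gt_zero])
  then have W: "K \<le> lambert_W ?z" using lambert_W_bounds(2)[OF assms(6)] by simp
  have "(1 - \<epsilon>) * ln (real n) / lambert_W ?z \<le> 1 * ln (real n) / lambert_W ?z"
    using assms W by (intro divide_right_mono mult_right_mono) auto
  also have "\<dots> \<le> ln (real n) / K" using assms W by (simp add: divide_left_mono)
  finally show ?thesis using clique_threshold_eq[OF assms(1,2,6)] by simp
qed

text \<open>The constant depends on the model parameters only, being fixed before \<open>n\<close>,
  \<open>d\<close>, \<open>k\<close> and \<open>\<epsilon>\<close>. The condition with
  \<open>- exp (- 1)\<close> keeps the argument in the domain where \<open>lambert_W\<close> is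
  specified.\<close>

theorem lemma19:
  fixes lam w0 \<beta> wc :: real
  assumes "lam > 0" and "w0 > 0" and "\<beta> > 2" and "wc > w0"
  shows "\<exists>c1>0.
    (\<forall>n d k :: nat. 1 \<le> d \<longrightarrow> 1 \<le> k \<longrightarrow> k \<le> n \<longrightarrow>
       real n * (c1 * 2 ^ d * real k) powr (- real k) \<le> expected_cliques lam \<beta> w0 n d wc k) \<and>
    (\<forall>\<epsilon>>0. \<forall>d :: nat \<Rightarrow> nat. (\<forall>n. 1 \<le> d n) \<longrightarrow>
       (\<epsilon> < 1 \<longrightarrow>
          (\<lambda>n. clique_threshold c1 \<epsilon> n (d n))
            \<in> \<Theta>(\<lambda>n. ln (real n) / (real (d n) + ln (ln (real n))))) \<and>
       (\<forall>k :: nat \<Rightarrow> nat.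
          (\<forall>\<^sub>F n in sequentially. 1 \<le> k n \<and> - exp (- 1) \<le> clique_threshold_arg c1 \<epsilon> n (d n) \<and>
             real (k n) \<le> clique_threshold c1 \<epsilon> n (d n)) \<longrightarrow>
          (\<exists>r :: nat \<Rightarrow> real. r \<longlonglongrightarrow> 0 \<and>
             (\<forall>\<^sub>F n in sequentially.
                real n powr \<epsilon> + r n \<le> expected_cliques lam \<beta> w0 n (d n) wc (k n))) \<and>
          (\<lambda>n. variance_cliques lam \<beta> w0 n (d n) wc (k n)
                 / (expected_cliques lam \<beta> w0 n (d n) wc (k n))\<^sup>2) \<longlonglongrightarrow> 0))"
proof -
  interpret light_girg lam w0 \<beta> wc using assms by unfold_locales
  define c1 where "c1 = 1 / (light_prob * light_factor)"
  have "light_prob * light_factor \<le> 1 * 1"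
    using light_prob light_factor by (intro mult_mono) auto
  then have c1: "1 \<le> c1" using light_prob light_factor by (simp add: c1_def)
  have lower: "real n * (c1 * 2 ^ d * real k) powr (- real k) \<le> expected_cliques lam \<beta> w0 n d wc k"
    if "1 \<le> d" "1 \<le> k" "k \<le> n" for n d k
    unfolding c1_def using that by (rule expected_cliques_ge)
  have main: "(\<exists>r :: nat \<Rightarrow> real. r \<longlonglongrightarrow> 0 \<and>
             (\<forall>\<^sub>F n in sequentially.
                real n powr \<epsilon> + r n \<le> expected_cliques lam \<beta> w0 n (d n) wc (k n))) \<and>
          (\<lambda>n. variance_cliques lam \<beta> w0 n (d n) wc (k n)
                 / (expected_cliques lam \<beta> w0 n (d n) wc (k n))\<^sup>2) \<longlonglongrightarrow> 0"
    if \<epsilon>: "0 < \<epsilon>" and d: "\<forall>n. 1 \<le> d n"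
      and k: "\<forall>\<^sub>F n in sequentially. 1 \<le> k n \<and> - exp (- 1) \<le> clique_threshold_arg c1 \<epsilon> n (d n) \<and>
             real (k n) \<le> clique_threshold c1 \<epsilon> n (d n)"
    for \<epsilon> and d k :: "nat \<Rightarrow> nat"
  proof (cases "\<epsilon> < 1")
    case False
    \<comment> \<open>For \<open>\<epsilon> \<ge> 1\<close> the assumption on \<open>k\<close>
      eventually contradicts itself.\<close>
    have "\<forall>\<^sub>F n in sequentially. False"
      using k eventually_gt_at_top[of 0]
    proof eventually_elim
      case (elim n)
      then show ?case using clique_threshold_lt_1[of c1 \<epsilon> n "d n"] c1 False d by auto
    qed
    then show ?thesis by simp
  next
    case True
    let ?E = "\<lambda>n. expected_cliques lam \<beta> w0 n (d n) wc (k n)"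
    let ?V = "\<lambda>n. variance_cliques lam \<beta> w0 n (d n) wc (k n)"
    have pos: "0 < c1" using c1 by simp
    note arg_ge = eventually_clique_threshold_arg_ge[OF pos True, of _ d]
    \<comment> \<open>The bound \<open>clique_threshold_le\<close> with \<open>K = 1\<close> gives
      \<open>k \<le> ln n \<le> n\<close>, as the lower bound on the mean requires.\<close>
    have E: "\<forall>\<^sub>F n in sequentially. real n powr \<epsilon> \<le> ?E n"
      using k eventually_gt_at_top[of 0] arg_ge[of "exp 1"] arg_ge[of "exp (2 * 1)"]
    proof eventually_elim
      case (elim n)
      have "real (k n) \<le> ln (real n) / 1"
        using clique_threshold_le[of c1 n \<epsilon> 1 "d n"] elim pos \<epsilon> by linarith
      also have "\<dots> \<le> real n" using ln_le_minus_one[of "real n"] elim by simp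
      finally have "k n \<le> n" by simp
      then show ?case
        using powr_le_below_clique_threshold[of c1 n "k n" \<epsilon> "d n"] lower[of "d n" "k n" n] elim c1 d by fastforce
    qed
    \<comment> \<open>The choice \<open>K = 2 / \<epsilon>\<close> gives
      \<open>2 ^ k \<le> n powr (\<epsilon> / 2)\<close>, half of the exponent that the mean
      provides.\<close>
    have V: "\<forall>\<^sub>F n in sequentially. ?V n / (?E n)\<^sup>2 \<le> exp (lam * wc\<^sup>2) * real n powr (- \<epsilon> / 2)"
      using k E eventually_gt_at_top[of 0] arg_ge[of "exp 1"] arg_ge[of "exp (2 * (2 / \<epsilon>))"]
    proof eventually_elim
      case (elim n)
      have Epos: "0 < ?E n" using elim by (intro less_le_trans[OF _ elim(2)]) simp
      have "real (k n) \<le> ln (real n) / (2 / \<epsilon>)"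
        using clique_threshold_le[of c1 n \<epsilon> "2 / \<epsilon>" "d n"] elim pos \<epsilon> by (meson order_trans divide_pos_pos zero_less_numeral)
      then have "real (k n) * 1 \<le> \<epsilon> / 2 * ln (real n)" by (simp add: mult.commute)
      moreover have "real (k n) * ln 2 \<le> real (k n) * 1"
        using ln_2_less_1 by (intro mult_left_mono) auto
      ultimately have "exp (real (k n) * ln 2) \<le> exp (\<epsilon> / 2 * ln (real n))"
        by (subst exp_le_cancel_iff) linarith
      then have pow: "2 ^ k n \<le> real n powr (\<epsilon> / 2)"
        using elim by (simp add: powr_def exp_of_nat_mult)
      have "?V n / (?E n)\<^sup>2 \<le> 2 ^ k n * exp (lam * wc\<^sup>2) * ?E n / (?E n)\<^sup>2"
        using d elim by (intro divide_right_mono variance_cliques_le) auto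
      also have "\<dots> = 2 ^ k n * exp (lam * wc\<^sup>2) / ?E n"
        using Epos by (simp add: power2_eq_square)
      also have "\<dots> \<le> real n powr (\<epsilon> / 2) * exp (lam * wc\<^sup>2) / real n powr \<epsilon>"
        using pow elim Epos by (intro frac_le mult_right_mono mult_nonneg_nonneg) auto
      also have "\<dots> = exp (lam * wc\<^sup>2) * real n powr (- \<epsilon> / 2)"
        using elim by (simp add: powr_minus field_simps flip: powr_add)
      finally show ?case .
    qed
    have lim: "(\<lambda>n. exp (lam * wc\<^sup>2) * real n powr (- \<epsilon> / 2)) \<longlonglongrightarrow> 0"
      using \<epsilon> by real_asymp
    have nonneg: "0 \<le> ?V n" for n
      unfolding variance_cliques_def by (rule prob_space.variance_positive[OF prob_space_girg])
    have "(\<lambda>n. ?V n / (?E n)\<^sup>2) \<longlonglongrightarrow> 0"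
      by (rule tendsto_sandwich[OF _ V tendsto_const lim]) (auto intro!: always_eventually divide_nonneg_nonneg nonneg)
    \<comment> \<open>The mean bound holds without error term, so the \<open>o(1)\<close> is taken
      to be 0.\<close>
    then show ?thesis
      using E by (intro conjI exI[of _ "\<lambda>_. 0"]) auto
  qed
  show ?thesis
  proof (intro exI[of _ c1] conjI allI impI)
    show "0 < c1" using c1 by simp
  qed (use lower main clique_threshold_bigtheta c1 in \<open>simp_all\<close>)
qed

end
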